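(* For each dimension $d\in\mathbb{N}$, let $\varepsilon_d>0$, $y_d\in\mathbb{R}^d$ and $\Phi_d,R_d,I_d,\hat x_d,\Sigma_d,\mu^{y_d},\mathcal{L}_{\mu^{y_d}}$ be as in the context (all on $\mathbb{R}^d$). Suppose that for every $d\in\mathbb{N}$: (1) $\Phi_d,R_d\in C^3(\mathbb{R}^d,\mathbb{R})$, $I_d$ has a unique global minimizer $\hat x_d\in\mathbb{R}^d$, and $D^2I_d(\hat x_d)$ is positive definite; (2) $K_d>0$ is a constant such that $\max\{\|D^3\Phi_d(x)\|_{\Sigma_d},\|D^3R_d(x)\|_{\Sigma_d}\}\le K_d$ for all $x\in\mathbb{R}^d$; (3) $0<\delta_d\le1$ is such that $I_d(x)\ge\frac{\delta_d}{2}\|x-\hat x_d\|_{\Sigma_d}^2$ for all $x\in\mathbb{R}^d$. Suppose moreover that $\varepsilon_d^{1/2}K_d\to0$ as $d\to\infty$. If there exists $N_0\in\mathbb{N}$ such that $\delta_d\le e^{-1/2}$, $\varepsilon_d\le1$, and $$\frac{3}{\varepsilon_d^{1/2}K_d}\ge\left(\frac{8}{\delta_d}\ln\frac1{\delta_d}\right)^{3/2}d^{3/2}$$ for all $d\ge N_0$, then for every $C>2\sqrt2\,e/3$ there exists $N_1\ge N_0$ such that $$d_{\mathrm{TV}}(\mu^{y_d},\mathcal{L}_{\mu^{y_d}})\le C\,\varepsilon_d^{1/2}K_d\,d^{3/2}\qquad\text{for all }d\ge N_1.$$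
   Context: Let $|\cdot|$ be the Euclidean norm on $\mathbb{R}^d$. For each $d$ let $G_d:\mathbb{R}^d\to\mathbb{R}^d$ be a map, $y_d\in\mathbb{R}^d$, $\varepsilon_d>0$, and $R_d:\mathbb{R}^d\to\mathbb{R}$ such that $\exp(-R_d(x))$ is the Lebesgue density of a probability measure on $\mathbb{R}^d$ (the prior). Put $\Phi_d(x):=\frac12|y_d-G_d(x)|^2$. Let $\hat x_d$ be the unique minimizer of $\Phi_d+\varepsilon_dR_d$ and $I_d(x):=\Phi_d(x)+\varepsilon_dR_d(x)-\Phi_d(\hat x_d)-\varepsilon_dR_d(\hat x_d)$. The posterior $\mu^{y_d}$ is the probability measure with Lebesgue density proportional to $\exp(-\frac1{\varepsilon_d}I_d(x))$. Put $\Sigma_d:=(D^2I_d(\hat x_d))^{-1}$ (inverse Hessian) and $\mathcal{L}_{\mu^{y_d}}:=\mathcal{N}(\hat x_d,\varepsilon_d\Sigma_d)$ (the Laplace approximation). For symmetric positive definite $\Sigma$, $\|x\|_\Sigma:=|\Sigma^{-1/2}x|$, and for $g\in C^3(\mathbb{R}^d,\mathbb{R})$, $\|D^3g(x)\|_\Sigma:=\sup\{|D^3g(x)(h_1,h_2,h_3)|:\|h_1\|_\Sigma,\|h_2\|_\Sigma,\|h_3\|_\Sigma\le1\}$. Total variation distance: $d_{\mathrm{TV}}(\nu,\mu):=\sup_{A\in\mathcal{B}(\mathbb{R}^d)}|\nu(A)-\mu(A)|$. *)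

theory Defs
  imports
    "HOL-Probability.Probability"
    "Jordan_Normal_Form.Determinant"
    "Jordan_Normal_Form.Gauss_Jordan_Elimination"
begin

text \<open>The dimension is a variable that tends to infinity, so points of the \<open>d\<close>-dimensional
  Euclidean space are functions on \<open>{..<d}\<close>, extended by \<^term>\<open>undefined\<close>. These are the points of
  the library's product measure space. The Euclidean norm is \<^term>\<open>\<lambda>x. L2_set x {..<d}\<close>, and
  matrices are those of Jordan_Normal_Form.\<close>

definition eucl :: "nat \<Rightarrow> (nat \<Rightarrow> real) set" where
  "eucl d = ({..<d} \<rightarrow>\<^sub>E UNIV)"

definition leb :: "nat \<Rightarrow> (nat \<Rightarrow> real) measure" where
  "leb d = (\<Pi>\<^sub>M i\<in>{..<d}. lborel)"

subsection \<open>Derivatives\<close>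

definition partial :: "nat \<Rightarrow> ((nat \<Rightarrow> real) \<Rightarrow> real) \<Rightarrow> (nat \<Rightarrow> real) \<Rightarrow> real" where
  "partial i g x = deriv (\<lambda>t. g (x(i := t))) (x i)"

text \<open>Continuity refers to the product topology on functions, which induces the Euclidean topology
  on \<^term>\<open>eucl d\<close>.\<close>

primrec C_k_on_eucl :: "nat \<Rightarrow> nat \<Rightarrow> ((nat \<Rightarrow> real) \<Rightarrow> real) \<Rightarrow> bool" where
  "C_k_on_eucl d 0 g \<longleftrightarrow> continuous_on (eucl d) g"
| "C_k_on_eucl d (Suc k) g \<longleftrightarrow> continuous_on (eucl d) g \<and>
     (\<forall>i<d. (\<forall>x\<in>eucl d. (\<lambda>t. g (x(i := t))) field_differentiable (at (x i))) \<and>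
            C_k_on_eucl d k (partial i g))"

definition hessian :: "nat \<Rightarrow> ((nat \<Rightarrow> real) \<Rightarrow> real) \<Rightarrow> (nat \<Rightarrow> real) \<Rightarrow> real mat" where
  "hessian d g x = Matrix.mat d d (\<lambda>(i, j). partial i (partial j g) x)"

definition D3 :: "nat \<Rightarrow> ((nat \<Rightarrow> real) \<Rightarrow> real) \<Rightarrow> (nat \<Rightarrow> real)
    \<Rightarrow> (nat \<Rightarrow> real) \<Rightarrow> (nat \<Rightarrow> real) \<Rightarrow> (nat \<Rightarrow> real) \<Rightarrow> real" where
  "D3 d g x h1 h2 h3 =
     (\<Sum>i<d. \<Sum>j<d. \<Sum>k<d. partial i (partial j (partial k g)) x * h1 i * h2 j * h3 k)"

subsection \<open>Positive definite matrices and the norms they induce\<close>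

definition pos_def_mat :: "nat \<Rightarrow> real mat \<Rightarrow> bool" where
  "pos_def_mat d A \<longleftrightarrow> A \<in> carrier_mat d d \<and> transpose_mat A = A \<and>
     (\<forall>v\<in>carrier_vec d. v \<noteq> 0\<^sub>v d \<longrightarrow> Matrix.scalar_prod v (A *\<^sub>v v) > 0)"

text \<open>Only meaningful for invertible \<open>A\<close>.\<close>

definition inv_mat :: "real mat \<Rightarrow> real mat" where
  "inv_mat A = the (mat_inverse A)"

text \<open>The positive definite square root; only meaningful for positive definite \<open>A\<close>, where it
  exists and is unique.\<close>

definition sqrt_mat :: "nat \<Rightarrow> real mat \<Rightarrow> real mat" where
  "sqrt_mat d A = (THE B. pos_def_mat d B \<and> B * B = A)"

text \<open>The Euclidean norm of \<open>\<Sigma>\<^sup>-\<^sup>1\<^sup>/\<^sup>2 x\<close>.\<close>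

definition mat_norm :: "nat \<Rightarrow> real mat \<Rightarrow> (nat \<Rightarrow> real) \<Rightarrow> real" where
  "mat_norm d S x =
     L2_set (\<lambda>i. vec_index (inv_mat (sqrt_mat d S) *\<^sub>v Matrix.vec d x) i) {..<d}"

definition D3_norm :: "nat \<Rightarrow> real mat \<Rightarrow> ((nat \<Rightarrow> real) \<Rightarrow> real) \<Rightarrow> (nat \<Rightarrow> real) \<Rightarrow> real" where
  "D3_norm d S g x = Sup {\<bar>D3 d g x h1 h2 h3\<bar> | h1 h2 h3.
     h1 \<in> eucl d \<and> h2 \<in> eucl d \<and> h3 \<in> eucl d \<and>
     mat_norm d S h1 \<le> 1 \<and> mat_norm d S h2 \<le> 1 \<and> mat_norm d S h3 \<le> 1}"

subsection \<open>Measures\<close>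

definition unique_minimizer :: "nat \<Rightarrow> ((nat \<Rightarrow> real) \<Rightarrow> real) \<Rightarrow> (nat \<Rightarrow> real) \<Rightarrow> bool" where
  "unique_minimizer d f x \<longleftrightarrow> (\<forall>z. is_arg_min f (\<lambda>u. u \<in> eucl d) z \<longleftrightarrow> z = x)"

definition posterior :: "nat \<Rightarrow> real \<Rightarrow> ((nat \<Rightarrow> real) \<Rightarrow> real) \<Rightarrow> (nat \<Rightarrow> real) measure" where
  "posterior d e I = density (leb d)
     (\<lambda>x. ennreal (exp (- (1 / e) * I x) / (\<integral>u. exp (- (1 / e) * I u) \<partial>leb d)))"

definition gaussian :: "nat \<Rightarrow> (nat \<Rightarrow> real) \<Rightarrow> real mat \<Rightarrow> (nat \<Rightarrow> real) measure" where
  "gaussian d m S = density (leb d)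
     (\<lambda>x. let v = Matrix.vec d (\<lambda>i. x i - m i) in
        ennreal (exp (- (1 / 2) * Matrix.scalar_prod v (inv_mat S *\<^sub>v v))
                 / sqrt ((2 * pi) ^ d * Determinant.det S)))"

definition tv_dist :: "nat \<Rightarrow> (nat \<Rightarrow> real) measure \<Rightarrow> (nat \<Rightarrow> real) measure \<Rightarrow> real" where
  "tv_dist d \<nu> \<mu> = (SUP A\<in>sets (leb d). \<bar>measure \<nu> A - measure \<mu> A\<bar>)"

end

theory Submission
  imports Defs "Jordan_Normal_Form.Spectral_Radius"
begin

text \<open>In the coordinate \<open>u = (\<epsilon> \<Sigma>)\<^sup>-\<^sup>1\<^sup>/\<^sup>2 (x - xhat)\<close> the posterior has an unnormalised density \<open>f\<close> with
  \<open>f \<le> exp (- \<delta> |u|\<^sup>2 / 2)\<close>, and Taylor's theorem at the minimizer bounds the difference between \<open>- ln f\<close>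
  and \<open>|u|\<^sup>2 / 2\<close> by \<open>k |u|\<^sup>3 / 3\<close>, where \<open>k = sqrt \<epsilon> K\<close>. The total variation distance is at most twice
  the \<open>L\<^sup>1\<close> distance of \<open>f\<close> and \<open>g = exp (- |u|\<^sup>2 / 2)\<close>, relative to the mass of \<open>g\<close>. With
  \<open>b\<^sup>3 = 3 / k\<close> this distance is estimated by \<open>e k |u|\<^sup>3 g / 3\<close> on the ball of radius \<open>b\<close>, and by
  \<open>exp (- \<delta> b\<^sup>2 / 4) exp (- \<delta> |u|\<^sup>2 / 4)\<close> outside it; the growth condition on \<open>3 / k\<close> makes the second
  contribution smaller than \<open>k d\<^sup>3\<^sup>/\<^sup>2\<close>. Because
  \<open>|u|\<^sup>3 \<le> d\<^sup>3\<^sup>/\<^sup>2 exp (3/2 (|u|\<^sup>2 / d - 1))\<close>, only Gaussian normalising constants are needed, never moments,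
  and those follow by completing squares, so no linear change of variables is needed either.\<close>

unbundle no vec_syntax
unbundle no inner_syntax

section \<open>Positive definite matrices\<close>

text \<open>The argument is a function rather than a vector, so that the form applies directly to
  differences such as \<open>\<lambda>i. x i - m i\<close>, whose values from index \<open>d\<close>
  on are irrelevant.\<close>

definition quad :: "nat \<Rightarrow> real mat \<Rightarrow> (nat \<Rightarrow> real) \<Rightarrow> real" where
  "quad d A x = (\<Sum>i<d. \<Sum>j<d. A $$ (i, j) * x i * x j)"

lemma scalar_prod_eq_quad:
  assumes "A \<in> carrier_mat d d" "v \<in> carrier_vec d"
  shows "v \<bullet> (A *\<^sub>v v) = quad d A (vec_index v)"
  using assms unfolding scalar_prod_def quad_def
  by (auto simp: scalar_prod_def sum_distrib_left lessThan_atLeast0 ac_simps intro!: sum.cong)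

lemma quad_cong: "(\<And>i. i < d \<Longrightarrow> x i = y i) \<Longrightarrow> quad d A x = quad d A y"
  unfolding quad_def by (intro sum.cong) auto

lemma quad_scale: "quad d A (\<lambda>i. c * x i) = c\<^sup>2 * quad d A x"
  unfolding quad_def by (simp add: sum_distrib_left power2_eq_square algebra_simps)

lemma pos_def_mat_iff_quad:
  "pos_def_mat d A \<longleftrightarrow> A \<in> carrier_mat d d \<and> transpose_mat A = A \<and>
     (\<forall>x. (\<exists>i<d. x i \<noteq> 0) \<longrightarrow> quad d A x > 0)"
proof -
  have "(\<forall>v\<in>carrier_vec d. v \<noteq> 0\<^sub>v d \<longrightarrow> v \<bullet> (A *\<^sub>v v) > 0) \<longleftrightarrow>
      (\<forall>x. (\<exists>i<d. x i \<noteq> 0) \<longrightarrow> quad d A x > 0)" if A: "A \<in> carrier_mat d d"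
  proof safe
    fix x :: "nat \<Rightarrow> real" and i assume *: "\<forall>v\<in>carrier_vec d. v \<noteq> 0\<^sub>v d \<longrightarrow> v \<bullet> (A *\<^sub>v v) > 0"
      and i: "i < d" "x i \<noteq> 0"
    have "vec d x \<noteq> 0\<^sub>v d" using i by (metis index_vec index_zero_vec(1))
    then have "vec d x \<bullet> (A *\<^sub>v vec d x) > 0" using * by auto
    then show "quad d A x > 0"
      using scalar_prod_eq_quad[OF A, of "vec d x"] quad_cong[of d "vec_index (vec d x)" x A] by auto
  next
    fix v :: "real vec"
    assume *: "\<forall>x. (\<exists>i<d. x i \<noteq> 0) \<longrightarrow> quad d A x > 0" and v: "v \<in> carrier_vec d" "v \<noteq> 0\<^sub>v d"
    then have "\<exists>i<d. vec_index v i \<noteq> 0" by (metis carrier_vecD eq_vecI index_zero_vec)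
    then show "v \<bullet> (A *\<^sub>v v) > 0" using * scalar_prod_eq_quad[OF A v(1)] by auto
  qed
  then show ?thesis unfolding pos_def_mat_def by blast
qed

lemma pos_def_mat_carrier: "pos_def_mat d A \<Longrightarrow> A \<in> carrier_mat d d"
  and pos_def_mat_transpose: "pos_def_mat d A \<Longrightarrow> transpose_mat A = A"
  unfolding pos_def_mat_def by auto

lemma pos_def_mat_quad_pos: "pos_def_mat d A \<Longrightarrow> i < d \<Longrightarrow> x i \<noteq> 0 \<Longrightarrow> quad d A x > 0"
  unfolding pos_def_mat_iff_quad by blast

lemma pos_def_mat_quad_nonneg: "pos_def_mat d A \<Longrightarrow> quad d A x \<ge> 0"
proof (cases "\<exists>i<d. x i \<noteq> 0")
  case True
  then show "pos_def_mat d A \<Longrightarrow> ?thesis" using pos_def_mat_quad_pos less_imp_le by blast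
next
  case False
  then show ?thesis unfolding quad_def by (simp add: sum_nonneg)
qed

section \<open>Inverse matrices and congruence\<close>

lemma inv_mat_inverts:
  assumes A: "A \<in> carrier_mat d d" and det: "det A \<noteq> 0"
  shows "inv_mat A \<in> carrier_mat d d" "A * inv_mat A = 1\<^sub>m d" "inv_mat A * A = 1\<^sub>m d"
proof -
  have "A \<in> Units (ring_mat TYPE(real) d ())"
    using det_non_zero_imp_unit[OF A det] .
  then have "mat_inverse A \<noteq> None" using mat_inverse(1)[OF A, where b = "()"] by blast
  then obtain B where "mat_inverse A = Some B" by auto
  with mat_inverse(2)[OF A this]
  show "inv_mat A \<in> carrier_mat d d" "A * inv_mat A = 1\<^sub>m d" "inv_mat A * A = 1\<^sub>m d"
    by (auto simp: inv_mat_def)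
qed

lemma inverse_mat_unique:
  fixes A :: "real mat"
  assumes A: "A \<in> carrier_mat d d" and B: "B \<in> carrier_mat d d" and C: "C \<in> carrier_mat d d"
    and AB: "A * B = 1\<^sub>m d" and CA: "C * A = 1\<^sub>m d"
  shows "C = B"
proof -
  have "C = C * (A * B)" using AB C by simp
  also have "\<dots> = (C * A) * B" using A B C by simp
  also have "\<dots> = B" using CA B by simp
  finally show ?thesis .
qed

text \<open>A right inverse suffices, because \<open>A * B = 1\<^sub>m d\<close> forces
  \<open>det A\<close> to be nonzero.\<close>

lemma inv_mat_eqI:
  assumes A: "A \<in> carrier_mat d d" and B: "B \<in> carrier_mat d d" and AB: "A * B = 1\<^sub>m d"
  shows "inv_mat A = B"
proof -
  have "det A * det B = 1" using det_mult[OF A B] AB by simp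
  then have "det A \<noteq> 0" by auto
  from inv_mat_inverts[OF A this] show ?thesis
    using inverse_mat_unique[OF A B _ AB] by blast
qed

lemma pos_def_mat_det_nonzero:
  assumes "pos_def_mat d A" shows "det A \<noteq> 0"
proof
  note A = pos_def_mat_carrier[OF assms]
  assume "det A = 0"
  then obtain v where v: "v \<in> carrier_vec d" "v \<noteq> 0\<^sub>v d" "A *\<^sub>v v = 0\<^sub>v d"
    using det_0_iff_vec_prod_zero_field[OF A] by blast
  then have "v \<bullet> (A *\<^sub>v v) > 0" using assms unfolding pos_def_mat_def by blast
  then show False using v by simp
qed

lemma pos_def_mat_inv_inverts:
  assumes "pos_def_mat d A"
  shows "inv_mat A \<in> carrier_mat d d" "A * inv_mat A = 1\<^sub>m d" "inv_mat A * A = 1\<^sub>m d"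
  using inv_mat_inverts[OF pos_def_mat_carrier[OF assms] pos_def_mat_det_nonzero[OF assms]] .

lemma inv_mat_inv_mat:
  assumes "pos_def_mat d A" shows "inv_mat (inv_mat A) = A"
  using pos_def_mat_inv_inverts[OF assms] pos_def_mat_carrier[OF assms] by (intro inv_mat_eqI)

lemma symmetric_inv_mat:
  assumes A: "A \<in> carrier_mat d d" and det: "det A \<noteq> 0" and sym: "transpose_mat A = A"
  shows "transpose_mat (inv_mat A) = inv_mat A"
proof -
  note i = inv_mat_inverts[OF A det]
  have "transpose_mat (inv_mat A) * A = transpose_mat (A * inv_mat A)"
    using transpose_mult[OF A i(1)] sym by simp
  also have "\<dots> = 1\<^sub>m d" using i(2) by simp
  finally show ?thesis using inverse_mat_unique[OF A i(1) _ i(2)] i(1) by auto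
qed

lemma symmetric_scalar_prod:
  fixes A :: "'a :: comm_semiring_0 mat"
  assumes "A \<in> carrier_mat d d" "transpose_mat A = A" "x \<in> carrier_vec d" "y \<in> carrier_vec d"
  shows "(A *\<^sub>v y) \<bullet> x = y \<bullet> (A *\<^sub>v x)"
  using transpose_vec_mult_scalar[OF assms(1,3,4)] assms(2) by simp

text \<open>Since \<open>W\<close> is symmetric, the form of \<open>W * A * W\<close> at
  \<open>v\<close> is that of \<open>A\<close> at \<open>W *\<^sub>v v\<close>, which is nonzero
  because \<open>W\<close> is invertible. This serves both for inverses and for transporting square
  roots through reflections.\<close>

lemma pos_def_mat_congruence:
  fixes A W :: "real mat"
  assumes pd: "pos_def_mat d A" and W: "W \<in> carrier_mat d d" "transpose_mat W = W" "det W \<noteq> 0"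
  shows "pos_def_mat d (W * A * W)"
  unfolding pos_def_mat_def
proof (intro conjI ballI impI)
  note A = pos_def_mat_carrier[OF pd]
  show "W * A * W \<in> carrier_mat d d" using W A by simp
  have "transpose_mat (W * A * W) = transpose_mat W * (transpose_mat A * transpose_mat W)"
    using transpose_mult[of "W * A" d d W d] transpose_mult[of W d d A d] A W by simp
  then show "transpose_mat (W * A * W) = W * A * W"
    using A W pos_def_mat_transpose[OF pd] by simp
  fix v :: "real vec" assume v: "v \<in> carrier_vec d" "v \<noteq> 0\<^sub>v d"
  let ?w = "W *\<^sub>v v"
  have w: "?w \<in> carrier_vec d" using W v by simp
  have "?w \<noteq> 0\<^sub>v d" using det_0_iff_vec_prod_zero_field[OF W(1)] W(3) v by blast
  then have "?w \<bullet> (A *\<^sub>v ?w) > 0" using pd w unfolding pos_def_mat_def by blast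
  also have "?w \<bullet> (A *\<^sub>v ?w) = v \<bullet> (W *\<^sub>v (A *\<^sub>v ?w))"
    using symmetric_scalar_prod[OF W(1,2), of "A *\<^sub>v ?w" v] A v W by simp
  also have "W *\<^sub>v (A *\<^sub>v ?w) = (W * A * W) *\<^sub>v v"
    using A W v by (simp add: assoc_mult_mat_vec[of _ d d _ d])
  finally show "v \<bullet> ((W * A * W) *\<^sub>v v) > 0" .
qed

text \<open>The inverse is congruent to \<open>A\<close>, as it equals
  \<open>inv_mat A * A * inv_mat A\<close>.\<close>

lemma pos_def_mat_inv_mat:
  assumes pd: "pos_def_mat d A" shows "pos_def_mat d (inv_mat A)"
proof -
  note A = pos_def_mat_carrier[OF pd] and i = pos_def_mat_inv_inverts[OF pd]
  have "det (inv_mat A) * det A = 1" using det_mult[OF i(1) A] i(3) by simp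
  then have "pos_def_mat d (inv_mat A * A * inv_mat A)"
    using symmetric_inv_mat[OF A pos_def_mat_det_nonzero[OF pd] pos_def_mat_transpose[OF pd]] i(1)
    by (intro pos_def_mat_congruence[OF pd]) auto
  then show ?thesis using i by simp
qed

text \<open>With \<open>X = B - C\<close> and \<open>B\<^sup>2 = C\<^sup>2\<close> one has \<open>B X + X C = 0\<close>, so the traces of \<open>X B X\<close> and
  \<open>X C X\<close>, both nonnegative, add up to zero.\<close>

lemma pos_def_sqrt_unique:
  assumes B: "pos_def_mat d B" and C: "pos_def_mat d C" and eq: "B * B = C * C"
  shows "B = C"
proof -
  note Bc = pos_def_mat_carrier[OF B] and Cc = pos_def_mat_carrier[OF C]
  define b c where "b i j = B $$ (i, j)" and "c i j = C $$ (i, j)" for i j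
  have bs: "b i j = b j i" if "i < d" "j < d" for i j
    using pos_def_mat_transpose[OF B] Bc that unfolding b_def
    by (metis carrier_matD index_transpose_mat(1))
  have cs: "c i j = c j i" if "i < d" "j < d" for i j
    using pos_def_mat_transpose[OF C] Cc that unfolding c_def
    by (metis carrier_matD index_transpose_mat(1))
  define x where "x i j = b i j - c i j" for i j
  have xs: "x i j = x j i" if "i < d" "j < d" for i j using bs cs that x_def by simp
  have sq: "(\<Sum>k<d. b i k * b k j) = (\<Sum>k<d. c i k * c k j)" if "i < d" "j < d" for i j
  proof -
    have "(B * B) $$ (i, j) = (C * C) $$ (i, j)" using eq by simp
    then show ?thesis using Bc Cc that by (simp add: scalar_prod_def b_def c_def lessThan_atLeast0)
  qed
  \<comment> \<open>This is \<open>B X + X C = 0\<close>: in \<open>B (B - C) + (B - C) C\<close>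
    the mixed products cancel and \<open>B\<^sup>2 - C\<^sup>2\<close> remains.\<close>
  have zero: "(\<Sum>k<d. b i k * x k j) + (\<Sum>k<d. x i k * c k j) = 0" if "i < d" "j < d" for i j
  proof -
    have "(\<Sum>k<d. b i k * x k j) + (\<Sum>k<d. x i k * c k j)
        = (\<Sum>k<d. b i k * b k j) - (\<Sum>k<d. c i k * c k j)"
      unfolding sum.distrib[symmetric] sum_subtractf[symmetric]
      by (intro sum.cong) (auto simp: x_def algebra_simps)
    then show ?thesis using sq that by simp
  qed
  \<comment> \<open>As \<open>X\<close> is symmetric, the form of \<open>B\<close> summed over the
    columns of \<open>X\<close> is the trace of \<open>X B X\<close>; likewise for
    \<open>C\<close>.\<close>
  have "(\<Sum>j<d. quad d B (\<lambda>i. x i j)) + (\<Sum>j<d. quad d C (\<lambda>i. x i j)) =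
     (\<Sum>j<d. \<Sum>i<d. x i j * (\<Sum>k<d. b i k * x k j)) + (\<Sum>j<d. \<Sum>i<d. x i j * (\<Sum>k<d. x i k * c k j))"
  proof -
    have "(\<Sum>j<d. quad d B (\<lambda>i. x i j)) = (\<Sum>j<d. \<Sum>i<d. x i j * (\<Sum>k<d. b i k * x k j))"
      unfolding quad_def b_def by (simp add: sum_distrib_left algebra_simps)
    moreover have "(\<Sum>j<d. quad d C (\<lambda>i. x i j)) = (\<Sum>j<d. \<Sum>i<d. x j i * (\<Sum>k<d. x j k * c k i))"
      unfolding quad_def c_def[symmetric] sum_distrib_left
      by (intro sum.cong refl) (auto simp: xs cs)
    moreover have "\<dots> = (\<Sum>j<d. \<Sum>i<d. x i j * (\<Sum>k<d. x i k * c k j))"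
      by (rule sum.swap)
    ultimately show ?thesis by simp
  qed
  also have "\<dots> = (\<Sum>j<d. \<Sum>i<d. x i j * ((\<Sum>k<d. b i k * x k j) + (\<Sum>k<d. x i k * c k j)))"
    by (simp add: sum.distrib distrib_left)
  also have "\<dots> = 0" using zero by simp
  finally have sum0: "(\<Sum>j<d. quad d B (\<lambda>i. x i j)) + (\<Sum>j<d. quad d C (\<lambda>i. x i j)) = 0" .
  have nn: "(\<Sum>j<d. quad d B (\<lambda>i. x i j)) \<ge> 0" "(\<Sum>j<d. quad d C (\<lambda>i. x i j)) \<ge> 0"
    by (intro sum_nonneg pos_def_mat_quad_nonneg B C)+
  then have "(\<Sum>j<d. quad d B (\<lambda>i. x i j)) = 0" using sum0 by linarith
  then have "quad d B (\<lambda>i. x i j) = 0" if "j < d" for j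
    using that sum_nonneg_eq_0_iff[of "{..<d}" "\<lambda>j. quad d B (\<lambda>i. x i j)"]
      pos_def_mat_quad_nonneg[OF B] by auto
  then have "x i j = 0" if "i < d" "j < d" for i j
    using pos_def_mat_quad_pos[OF B that(1), of "\<lambda>i. x i j"] that by fastforce
  then show ?thesis using Bc Cc unfolding x_def b_def c_def by (intro eq_matI) auto
qed

section \<open>Existence of the square root: real eigenvectors and reflections\<close>

lemma scalar_prod_self_pos:
  fixes v :: "real vec"
  assumes v: "v \<in> carrier_vec d" "v \<noteq> 0\<^sub>v d" shows "v \<bullet> v > 0"
proof -
  obtain i where "i < d" "v $ i \<noteq> 0" using v by (metis carrier_vecD eq_vecI index_zero_vec)
  then show ?thesis
    using v unfolding scalar_prod_def by (intro sum_pos2[of _ i]) (auto simp: zero_less_mult_iff)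
qed

text \<open>A complex eigenvector \<open>w = p + i q\<close> exists because the spectrum is
  nonempty. Equating \<open>(A p) \<bullet> q\<close> with \<open>p \<bullet> (A q)\<close> gives
  \<open>Im l * (p \<bullet> p + q \<bullet> q) = 0\<close>, so the eigenvalue is real. Then
  \<open>p\<close> and \<open>q\<close> both satisfy the eigenvector equation, and one of them is
  nonzero.\<close>

lemma symmetric_mat_real_eigenvector:
  fixes A :: "real mat"
  assumes A: "A \<in> carrier_mat d d" and sym: "transpose_mat A = A" and d: "d > 0"
  obtains v l where "v \<in> carrier_vec d" "v \<noteq> 0\<^sub>v d" "A *\<^sub>v v = l \<cdot>\<^sub>v v"
proof -
  let ?A = "map_mat complex_of_real A"
  have cA: "?A \<in> carrier_mat d d" using A by simp
  from spectrum_non_empty[OF cA d] obtain l w where w: "w \<in> carrier_vec d" "w \<noteq> 0\<^sub>v d"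
    and ev: "?A *\<^sub>v w = l \<cdot>\<^sub>v w"
    using cA unfolding spectrum_def eigenvalue_def eigenvector_def by auto
  define p q where "p = vec d (\<lambda>i. Re (w $ i))" and "q = vec d (\<lambda>i. Im (w $ i))"
  have pq: "p \<in> carrier_vec d" "q \<in> carrier_vec d" unfolding p_def q_def by auto
  have comp: "(\<Sum>j<d. complex_of_real (A $$ (i, j)) * w $ j) = l * w $ i" if "i < d" for i
  proof -
    have "(?A *\<^sub>v w) $ i = (l \<cdot>\<^sub>v w) $ i" using ev by simp
    then show ?thesis using that A w by (simp add: scalar_prod_def lessThan_atLeast0)
  qed
  have Ap: "A *\<^sub>v p = Re l \<cdot>\<^sub>v p - Im l \<cdot>\<^sub>v q"
  proof (rule eq_vecI)
    fix i assume "i < dim_vec (Re l \<cdot>\<^sub>v p - Im l \<cdot>\<^sub>v q)"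
    then have i: "i < d" by (simp add: q_def)
    have "(A *\<^sub>v p) $ i = Re (\<Sum>j<d. complex_of_real (A $$ (i, j)) * w $ j)"
      using i A by (simp add: scalar_prod_def lessThan_atLeast0 p_def)
    then show "(A *\<^sub>v p) $ i = (Re l \<cdot>\<^sub>v p - Im l \<cdot>\<^sub>v q) $ i"
      using comp[OF i] i by (simp add: p_def q_def)
  qed (use A in \<open>simp add: q_def\<close>)
  have Aq: "A *\<^sub>v q = Im l \<cdot>\<^sub>v p + Re l \<cdot>\<^sub>v q"
  proof (rule eq_vecI)
    fix i assume "i < dim_vec (Im l \<cdot>\<^sub>v p + Re l \<cdot>\<^sub>v q)"
    then have i: "i < d" by (simp add: q_def)
    have "(A *\<^sub>v q) $ i = Im (\<Sum>j<d. complex_of_real (A $$ (i, j)) * w $ j)"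
      using i A by (simp add: scalar_prod_def lessThan_atLeast0 q_def)
    then show "(A *\<^sub>v q) $ i = (Im l \<cdot>\<^sub>v p + Re l \<cdot>\<^sub>v q) $ i"
      using comp[OF i] i by (simp add: p_def q_def)
  qed (use A in \<open>simp add: q_def\<close>)
  have "(A *\<^sub>v p) \<bullet> q = p \<bullet> (A *\<^sub>v q)" by (rule symmetric_scalar_prod[OF A sym pq(2,1)])
  then have "Re l * (p \<bullet> q) - Im l * (q \<bullet> q) = Im l * (p \<bullet> p) + Re l * (p \<bullet> q)"
    unfolding Ap Aq using pq
    by (simp add: minus_scalar_prod_distrib[of _ d] scalar_prod_add_distrib[of _ d])
  then have "Im l * (p \<bullet> p + q \<bullet> q) = 0" by (simp add: algebra_simps)
  moreover have nz: "p \<noteq> 0\<^sub>v d \<or> q \<noteq> 0\<^sub>v d"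
  proof (rule ccontr)
    assume "\<not> ?thesis"
    then have "p $ i = 0 \<and> q $ i = 0" if "i < d" for i using that by simp
    then have "w = 0\<^sub>v d" using w by (intro eq_vecI) (auto simp: p_def q_def complex_eq_iff)
    then show False using w by simp
  qed
  moreover have "v \<bullet> v \<ge> 0" for v :: "real vec"
    by (auto simp: scalar_prod_def intro: sum_nonneg)
  ultimately have "Im l = 0"
    using scalar_prod_self_pos[OF pq(1)] scalar_prod_self_pos[OF pq(2)]
    by (metis add_nonneg_eq_0_iff less_irrefl mult_eq_0_iff)
  then have "A *\<^sub>v p = Re l \<cdot>\<^sub>v p" "A *\<^sub>v q = Re l \<cdot>\<^sub>v q"
    using Ap Aq pq by (auto intro!: eq_vecI)
  then show thesis using nz pq that by blast
qed

lemma orthogonal_symmetric_mat_with_first_col: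
  fixes v :: "real vec"
  assumes v: "v \<in> carrier_vec (Suc n)" and unit: "v \<bullet> v = 1"
  obtains W :: "real mat" where "W \<in> carrier_mat (Suc n) (Suc n)" "transpose_mat W = W"
    "W * W = 1\<^sub>m (Suc n)" "W *\<^sub>v unit_vec (Suc n) 0 = v"
proof -
  \<comment> \<open>The Householder reflection in the hyperplane orthogonal to \<open>v - e\<^sub>0\<close>. If \<open>v = e\<^sub>0\<close> then \<open>c = 2 / 0 = 0\<close>
    and \<open>W\<close> is the identity.\<close>
  define w where "w i = v $ i - of_bool (i = 0)" for i
  define s where "s = (\<Sum>k<Suc n. w k * w k)"
  define c where "c = 2 / s"
  define W where "W = mat (Suc n) (Suc n) (\<lambda>(i, j). of_bool (i = j) - c * w i * w j)"
  have W: "W \<in> carrier_mat (Suc n) (Suc n)" unfolding W_def by simp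
  have cs: "c * c * s = 2 * c" by (simp add: c_def)
  have "(\<Sum>k<Suc n. v $ k * v $ k) = 1"
    using unit v by (simp add: scalar_prod_def lessThan_atLeast0)
  then have s: "s = 2 - 2 * v $ 0"
    unfolding s_def w_def sum.lessThan_Suc_shift by (simp add: algebra_simps)
  have "W * W = 1\<^sub>m (Suc n)"
  proof (rule eq_matI)
    fix i j assume "i < dim_row (1\<^sub>m (Suc n) :: real mat)" "j < dim_col (1\<^sub>m (Suc n) :: real mat)"
    then have ij: "i < Suc n" "j < Suc n" by auto
    have "(W * W) $$ (i, j) = (\<Sum>k<Suc n. (of_bool (i = k) - c * w i * w k) * (of_bool (k = j) - c * w k * w j))"
      using ij by (simp add: scalar_prod_def lessThan_atLeast0 W_def)
    also have "\<dots> = (\<Sum>k<Suc n. of_bool (i = k) * (of_bool (k = j) - c * w k * w j))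
        - (\<Sum>k<Suc n. of_bool (k = j) * (c * w i * w k)) + (\<Sum>k<Suc n. c * c * w i * w j * (w k * w k))"
      unfolding sum_subtractf[symmetric] sum.distrib[symmetric]
      by (intro sum.cong) (auto simp: algebra_simps)
    also have "\<dots> = of_bool (i = j) - c * w i * w j - c * w i * w j + c * c * s * w i * w j"
      using ij unfolding s_def sum_distrib_left[symmetric]
      by (simp add: of_bool_def if_distrib[of "\<lambda>t. t * _"] sum.delta sum.delta' del: sum.lessThan_Suc cong: if_cong)
    also have "\<dots> = of_bool (i = j)" by (simp add: cs)
    finally show "(W * W) $$ (i, j) = 1\<^sub>m (Suc n) $$ (i, j)" using ij by simp
  qed (simp_all add: W_def)
  moreover have "W *\<^sub>v unit_vec (Suc n) 0 = v"
  proof (rule eq_vecI)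
    fix i assume "i < dim_vec v"
    then have i: "i < Suc n" using v by simp
    \<comment> \<open>The formula for \<open>s\<close> says \<open>s = - 2 * w 0\<close>; if
      \<open>s = 0\<close>, all coordinates of \<open>w\<close> vanish instead.\<close>
    have "c * w 0 = -1 \<or> (c = 0 \<and> w i = 0)"
    proof (cases "s = 0")
      case True
      then have "w i * w i = 0"
        using i sum_nonneg_eq_0_iff[of "{..<Suc n}" "\<lambda>k. w k * w k"] unfolding s_def by auto
      then show ?thesis using True by (simp add: c_def)
    next
      case False
      then show ?thesis using s by (simp add: c_def w_def field_simps)
    qed
    then have "of_bool (i = 0) - c * w 0 * w i = v $ i" unfolding w_def by auto
    moreover have "(W *\<^sub>v unit_vec (Suc n) 0) $ i = W $$ (i, 0)"
      using W i by simp
    ultimately show "(W *\<^sub>v unit_vec (Suc n) 0) $ i = v $ i"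
      using i by (simp add: W_def algebra_simps)
  qed (use v W in simp)
  moreover have "transpose_mat W = W" by (rule eq_matI) (auto simp: W_def)
  ultimately show thesis using W that by blast
qed

text \<open>Induction on the dimension. A reflection \<open>W\<close> taking the first basis vector
  to a unit eigenvector makes \<open>W * A * W\<close> block diagonal, with the eigenvalue in the
  corner. The square root of the remaining block is extended by the root of the eigenvalue and
  conjugated back by \<open>W\<close>, which is its own inverse.\<close>

lemma pos_def_sqrt_exists:
  "pos_def_mat d A \<Longrightarrow> \<exists>B. pos_def_mat d B \<and> B * B = A"
proof (induction d arbitrary: A)
  case 0
  then have "A \<in> carrier_mat 0 0" by (rule pos_def_mat_carrier)
  then have "A * A = A" by (intro eq_matI) auto
  then show ?case using 0 by blast
next
  case (Suc n)
  note A = pos_def_mat_carrier[OF Suc.prems]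
  obtain v0 l where v0: "v0 \<in> carrier_vec (Suc n)" "v0 \<noteq> 0\<^sub>v (Suc n)" "A *\<^sub>v v0 = l \<cdot>\<^sub>v v0"
    using symmetric_mat_real_eigenvector[OF A pos_def_mat_transpose[OF Suc.prems]] by blast
  have nv: "v0 \<bullet> v0 > 0" using scalar_prod_self_pos[OF v0(1,2)] .
  define v where "v = (1 / sqrt (v0 \<bullet> v0)) \<cdot>\<^sub>v v0"
  have v: "v \<in> carrier_vec (Suc n)" using v0 by (simp add: v_def)
  have vv: "v \<bullet> v = 1" using v0 nv by (simp add: v_def field_simps)
  have Av: "A *\<^sub>v v = l \<cdot>\<^sub>v v"
    unfolding v_def using mult_mat_vec[OF A v0(1)] v0 by (simp add: smult_smult_assoc mult.commute)
  obtain W :: "real mat" where W: "W \<in> carrier_mat (Suc n) (Suc n)" "transpose_mat W = W"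
    "W * W = 1\<^sub>m (Suc n)" "W *\<^sub>v unit_vec (Suc n) 0 = v"
    using orthogonal_symmetric_mat_with_first_col[OF v vv] .
  have detW: "det W \<noteq> 0" using det_mult[OF W(1) W(1)] W(3) by auto
  define A1 where "A1 = W * A * W"
  have pd1: "pos_def_mat (Suc n) A1"
    unfolding A1_def using pos_def_mat_congruence[OF Suc.prems W(1,2) detW] .
  note A1 = pos_def_mat_carrier[OF pd1]
  have "A1 *\<^sub>v unit_vec (Suc n) 0 = W *\<^sub>v (A *\<^sub>v v)"
    unfolding A1_def using A W by (simp add: assoc_mult_mat_vec[of _ "Suc n" "Suc n" _ "Suc n"])
  also have "\<dots> = l \<cdot>\<^sub>v (W *\<^sub>v (W *\<^sub>v unit_vec (Suc n) 0))"
    using Av mult_mat_vec[OF W(1) v] W(4) by simp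
  also have "\<dots> = l \<cdot>\<^sub>v unit_vec (Suc n) 0"
    using assoc_mult_mat_vec[OF W(1) W(1), of "unit_vec (Suc n) 0"] W(3) by simp
  finally have col: "A1 *\<^sub>v unit_vec (Suc n) 0 = l \<cdot>\<^sub>v unit_vec (Suc n) 0" .
  \<comment> \<open>Together with symmetry this clears the first row and the first column off the
    corner.\<close>
  have col0: "A1 $$ (i, 0) = l * of_bool (i = 0)" if "i < Suc n" for i
    using arg_cong[OF col, of "\<lambda>u. u $ i"] that A1 by simp
  have sym1: "A1 $$ (i, j) = A1 $$ (j, i)" if "i < Suc n" "j < Suc n" for i j
    using pos_def_mat_transpose[OF pd1] A1 that by (metis carrier_matD index_transpose_mat(1))
  have quadA1: "quad (Suc n) A1 x = l * (x 0)\<^sup>2 + quad n (mat n n (\<lambda>(i, j). A1 $$ (Suc i, Suc j))) (\<lambda>i. x (Suc i))" for x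
    unfolding quad_def sum.lessThan_Suc_shift
    by (simp add: col0 sym1[of 0] power2_eq_square)
  have "quad (Suc n) A1 (\<lambda>i. of_bool (i = 0)) > 0"
    using pos_def_mat_quad_pos[OF pd1, of 0 "\<lambda>i. of_bool (i = 0)"] by simp
  then have l: "l > 0" unfolding quadA1 by (simp add: quad_def)
  define A' where "A' = mat n n (\<lambda>(i, j). A1 $$ (Suc i, Suc j))"
  have "pos_def_mat n A'"
    unfolding pos_def_mat_iff_quad
  proof (intro conjI allI impI)
    show "A' \<in> carrier_mat n n" by (simp add: A'_def)
    show "transpose_mat A' = A'" using sym1 by (intro eq_matI) (auto simp: A'_def)
    fix x :: "nat \<Rightarrow> real" assume "\<exists>i<n. x i \<noteq> 0"
    then obtain i where "i < n" "x i \<noteq> 0" by blast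
    then have "quad (Suc n) A1 (\<lambda>i. case i of 0 \<Rightarrow> 0 | Suc i \<Rightarrow> x i) > 0"
      using pos_def_mat_quad_pos[OF pd1, of "Suc i"] by simp
    then show "quad n A' x > 0" unfolding quadA1 A'_def by simp
  qed
  then obtain B' where B': "pos_def_mat n B'" "B' * B' = A'" using Suc.IH by blast
  note B'c = pos_def_mat_carrier[OF B'(1)]
  define B1 where "B1 = mat (Suc n) (Suc n) (\<lambda>(i, j). if i = 0 \<or> j = 0 then sqrt l * of_bool (i = j)
      else B' $$ (i - 1, j - 1))"
  have B1: "B1 \<in> carrier_mat (Suc n) (Suc n)" by (simp add: B1_def)
  have sB': "B' $$ (i, j) = B' $$ (j, i)" if "i < n" "j < n" for i j
    using pos_def_mat_transpose[OF B'(1)] B'c that by (metis carrier_matD index_transpose_mat(1))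
  have "B1 * B1 = A1"
  proof (rule eq_matI)
    fix i j assume "i < dim_row A1" "j < dim_col A1"
    then have ij: "i < Suc n" "j < Suc n" using A1 by auto
    have e: "(B1 * B1) $$ (i, j) = B1 $$ (i, 0) * B1 $$ (0, j) + (\<Sum>k<n. B1 $$ (i, Suc k) * B1 $$ (Suc k, j))"
      using ij B1 sum.lessThan_Suc_shift[of "\<lambda>k. B1 $$ (i, k) * B1 $$ (k, j)" n]
      by (simp add: scalar_prod_def lessThan_atLeast0)
    show "(B1 * B1) $$ (i, j) = A1 $$ (i, j)"
    proof (cases "i = 0 \<or> j = 0")
      case True
      then show ?thesis unfolding e using ij l col0 sym1[of 0 j] by (auto simp: B1_def)
    next
      case False
      then obtain i' j' where s: "i = Suc i'" "j = Suc j'" by (metis not0_implies_Suc)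
      have "(B1 * B1) $$ (i, j) = (B' * B') $$ (i', j')"
        unfolding e using ij s B'c by (simp add: B1_def scalar_prod_def lessThan_atLeast0)
      then show ?thesis using B'(2) s ij by (simp add: A'_def)
    qed
  qed (use A1 B1 in auto)
  have pdB1: "pos_def_mat (Suc n) B1"
    unfolding pos_def_mat_iff_quad
  proof (intro conjI allI impI)
    show "transpose_mat B1 = B1" using sB' by (intro eq_matI) (auto simp: B1_def)
    fix x :: "nat \<Rightarrow> real" assume "\<exists>i<Suc n. x i \<noteq> 0"
    then obtain i where i: "i < Suc n" "x i \<noteq> 0" by blast
    have q: "quad (Suc n) B1 x = sqrt l * (x 0)\<^sup>2 + quad n B' (\<lambda>i. x (Suc i))"
      unfolding quad_def sum.lessThan_Suc_shift by (simp add: B1_def power2_eq_square)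
    show "quad (Suc n) B1 x > 0"
    proof (cases i)
      case 0
      then show ?thesis unfolding q using l i pos_def_mat_quad_nonneg[OF B'(1)]
        by (simp add: add_pos_nonneg)
    next
      case (Suc j)
      then show ?thesis unfolding q
        using l i pos_def_mat_quad_pos[OF B'(1), of j "\<lambda>i. x (Suc i)"]
        by (simp add: add_nonneg_pos)
    qed
  qed (rule B1)
  have "(W * B1 * W) * (W * B1 * W) = W * B1 * (W * W) * B1 * W"
    using W(1) B1 by (simp add: assoc_mult_mat[of _ "Suc n" "Suc n" _ "Suc n" _ "Suc n"])
  also have "\<dots> = W * (B1 * B1) * W"
    unfolding W(3) using W(1) B1 by (simp add: assoc_mult_mat[of _ "Suc n" "Suc n" _ "Suc n" _ "Suc n"])
  also have "\<dots> = W * (W * A * W) * W" unfolding \<open>B1 * B1 = A1\<close> A1_def ..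
  also have "\<dots> = (W * W) * A * (W * W)"
    using W(1) A by (simp add: assoc_mult_mat[of _ "Suc n" "Suc n" _ "Suc n" _ "Suc n"])
  also have "\<dots> = A" using A W(3) by simp
  finally show ?case using pos_def_mat_congruence[OF pdB1 W(1,2) detW] by blast
qed

section \<open>The square root and the norm it induces\<close>

lemma sqrt_mat:
  assumes "pos_def_mat d A"
  shows "pos_def_mat d (sqrt_mat d A)" "sqrt_mat d A * sqrt_mat d A = A"
proof -
  have "\<exists>!B. pos_def_mat d B \<and> B * B = A"
    using pos_def_sqrt_exists[OF assms] pos_def_sqrt_unique by blast
  from theI'[OF this] show "pos_def_mat d (sqrt_mat d A)" "sqrt_mat d A * sqrt_mat d A = A"
    unfolding sqrt_mat_def by auto
qed

text \<open>The inverse of \<open>sqrt_mat d S\<close> is symmetric and squares to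
  \<open>inv_mat S\<close>. Most later estimates can therefore use \<open>quad\<close> in place of
  matrix square roots.\<close>

lemma mat_norm_power2:
  assumes pd: "pos_def_mat d S"
  shows "(mat_norm d S x)\<^sup>2 = quad d (inv_mat S) x"
proof -
  note sq = sqrt_mat[OF pd]
  define B where "B = inv_mat (sqrt_mat d S)"
  note R = pos_def_mat_carrier[OF sq(1)]
  have pdB: "pos_def_mat d B" unfolding B_def by (rule pos_def_mat_inv_mat[OF sq(1)])
  note B = pos_def_mat_carrier[OF pdB]
  have RB: "sqrt_mat d S * B = 1\<^sub>m d" unfolding B_def by (rule pos_def_mat_inv_inverts[OF sq(1)])
  have "S * (B * B) = sqrt_mat d S * (sqrt_mat d S * B) * B"
    using R B by (subst sq(2)[symmetric]) (simp add: assoc_mult_mat[of _ d d _ d _ d])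
  also have "\<dots> = 1\<^sub>m d" using RB R B by simp
  finally have inv: "inv_mat S = B * B"
    using inv_mat_eqI[OF pos_def_mat_carrier[OF pd] _ ] B by auto
  let ?v = "vec d x"
  have Bv: "B *\<^sub>v ?v \<in> carrier_vec d" using B by simp
  have "(mat_norm d S x)\<^sup>2 = (B *\<^sub>v ?v) \<bullet> (B *\<^sub>v ?v)"
    unfolding mat_norm_def B_def[symmetric] L2_set_def scalar_prod_def carrier_vecD[OF Bv]
    by (simp add: sum_nonneg lessThan_atLeast0 power2_eq_square del: index_mult_mat_vec)
  also have "\<dots> = ?v \<bullet> (B *\<^sub>v (B *\<^sub>v ?v))"
    using symmetric_scalar_prod[OF B pos_def_mat_transpose[OF pdB] Bv, of ?v] by simp
  also have "B *\<^sub>v (B *\<^sub>v ?v) = inv_mat S *\<^sub>v ?v" unfolding inv using B by simp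
  also have "?v \<bullet> (inv_mat S *\<^sub>v ?v) = quad d (inv_mat S) (vec_index ?v)"
    using B by (intro scalar_prod_eq_quad) (auto simp: inv)
  also have "\<dots> = quad d (inv_mat S) x" by (rule quad_cong) simp
  finally show ?thesis .
qed

lemma mat_norm_eq_sqrt_quad:
  assumes "pos_def_mat d S" shows "mat_norm d S x = sqrt (quad d (inv_mat S) x)"
  using mat_norm_power2[OF assms] L2_set_nonneg unfolding mat_norm_def
  by (metis real_sqrt_unique)

text \<open>With \<open>R = sqrt_mat d S\<close> one has \<open>h = R w\<close> for a vector
  \<open>w\<close> of Euclidean norm at most one, so absolute row sums of \<open>R\<close> bound the
  coordinates. This will show that the set in \<open>D3_norm\<close> is bounded above, so that its
  \<open>Sup\<close> is meaningful.\<close>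

lemma mat_norm_le_one_imp_bounded:
  assumes pd: "pos_def_mat d S"
  obtains b where "\<And>h i. mat_norm d S h \<le> 1 \<Longrightarrow> i < d \<Longrightarrow> \<bar>h i\<bar> \<le> b"
proof
  note sq = sqrt_mat(1)[OF pd]
  define R where "R = sqrt_mat d S"
  note Rc = pos_def_mat_carrier[OF sq, folded R_def]
  note i = pos_def_mat_inv_inverts[OF sq, folded R_def]
  fix h k assume h: "mat_norm d S h \<le> 1" and k: "k < d"
  define w where "w = inv_mat R *\<^sub>v vec d h"
  have w: "w \<in> carrier_vec d" using i(1) by (simp add: w_def)
  have "vec d h = R *\<^sub>v w"
    unfolding w_def using i Rc assoc_mult_mat_vec[OF Rc i(1), of "vec d h"] by simp
  then have "h k = (R *\<^sub>v w) $ k" using k by (metis index_vec)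
  also have "\<dots> = (\<Sum>j<d. R $$ (k, j) * w $ j)"
    using k Rc w by (simp add: scalar_prod_def lessThan_atLeast0)
  finally have "\<bar>h k\<bar> \<le> (\<Sum>j<d. \<bar>R $$ (k, j) * w $ j\<bar>)" by simp
  also have "\<dots> \<le> (\<Sum>j<d. \<bar>R $$ (k, j)\<bar>)"
  proof (rule sum_mono)
    fix j assume "j \<in> {..<d}"
    then have "\<bar>w $ j\<bar> \<le> L2_set (\<lambda>i. \<bar>w $ i\<bar>) {..<d}" by (intro member_le_L2_set) auto
    also have "\<dots> = mat_norm d S h"
      unfolding mat_norm_def R_def[symmetric] w_def[symmetric] by (simp add: L2_set_def)
    finally show "\<bar>R $$ (k, j) * w $ j\<bar> \<le> \<bar>R $$ (k, j)\<bar>"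
      using h by (simp add: abs_mult mult_left_le)
  qed
  also have "\<dots> \<le> (\<Sum>i<d. \<Sum>j<d. \<bar>R $$ (i, j)\<bar>)"
    using k by (intro member_le_sum[of k "{..<d}" "\<lambda>i. \<Sum>j<d. \<bar>R $$ (i, j)\<bar>"]) (auto intro: sum_nonneg)
  finally show "\<bar>h k\<bar> \<le> (\<Sum>i<d. \<Sum>j<d. \<bar>sqrt_mat d S $$ (i, j)\<bar>)" unfolding R_def .
qed

section \<open>Gaussian integrals\<close>

text \<open>The unit upper triangular matrix \<open>U\<close> eliminates the last column of
  \<open>A\<close> above the corner, so \<open>U * A\<close> is block lower triangular and has the
  determinant of \<open>A\<close>.\<close>

lemma det_eq_schur_complement:
  fixes A :: "real mat"
  assumes A: "A \<in> carrier_mat (Suc n) (Suc n)" and nz: "A $$ (n, n) \<noteq> 0"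
  shows "det A = A $$ (n, n) *
    det (mat n n (\<lambda>(i, j). A $$ (i, j) - A $$ (i, n) * A $$ (n, j) / A $$ (n, n)))"
proof -
  define a where "a = A $$ (n, n)"
  define S where "S = mat n n (\<lambda>(i, j). A $$ (i, j) - A $$ (i, n) * A $$ (n, j) / a)"
  define r where "r = mat 1 n (\<lambda>(i, j). A $$ (n, j))"
  define D where "D = mat 1 1 (\<lambda>_. a)"
  define U where "U = mat (Suc n) (Suc n)
    (\<lambda>(i, j). if i = j then 1 else if j = n then - A $$ (i, n) / a else 0)"
  have U: "U \<in> carrier_mat (Suc n) (Suc n)" by (simp add: U_def)
 have U_index: "U $$ (i, j) = (if i = j then 1 else if j = n then - A $$ (i, n) / a else 0)"
    if "i < Suc n" "j < Suc n" for i j using that by (simp add: U_def)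
  have "upper_triangular U" unfolding upper_triangular_def by (auto simp: U_def)
  then have "det U = (\<Prod>i = 0..<Suc n. U $$ (i, i))"
    using det_upper_triangular[OF _ U] U by (simp add: prod_list_diag_prod)
  then have detU: "det U = 1" by (simp add: U_def)
  have "U * A = four_block_mat S (0\<^sub>m n 1) r D"
  proof (rule eq_matI)
    fix i j assume "i < dim_row (four_block_mat S (0\<^sub>m n 1) r D)" "j < dim_col (four_block_mat S (0\<^sub>m n 1) r D)"
    then have ij: "i < Suc n" "j < Suc n" by (auto simp: S_def D_def)
    have "(U * A) $$ (i, j) = (\<Sum>k<n. U $$ (i, k) * A $$ (k, j)) + U $$ (i, n) * A $$ (n, j)"
      using ij A U by (simp add: scalar_prod_def lessThan_atLeast0)
    also have "(\<Sum>k<n. U $$ (i, k) * A $$ (k, j)) = (\<Sum>k<n. if k = i then A $$ (k, j) else 0)"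
      using ij by (intro sum.cong) (auto simp: U_def)
    also have "\<dots> = (if i < n then A $$ (i, j) else 0)" by simp
    finally show "(U * A) $$ (i, j) = four_block_mat S (0\<^sub>m n 1) r D $$ (i, j)"
      using ij nz A by (auto simp: less_Suc_eq U_index S_def r_def D_def a_def field_simps)
  qed (use A U in \<open>auto simp: S_def D_def\<close>)
  then have "det U * det A = det S * det D"
    using det_mult[OF U A] det_four_block_mat_upper_right_zero[of S n "0\<^sub>m n 1" 1 r D]
    by (simp add: S_def r_def D_def)
  moreover have "det D = a" by (simp add: D_def det_single)
  ultimately show ?thesis using detU by (simp add: S_def a_def)
qed

text \<open>Completing the square in the last variable produces the same Schur complement as the
  determinant formula, so that Gaussian integrals and determinants follow one recursion.\<close>

lemma quad_complete_square:
  assumes sym: "\<And>i. i < n \<Longrightarrow> A $$ (i, n) = A $$ (n, i)" and nz: "A $$ (n, n) \<noteq> 0"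
  shows "quad (Suc n) A x = A $$ (n, n) * (x n + (\<Sum>i<n. A $$ (n, i) * x i) / A $$ (n, n))\<^sup>2
    + quad n (mat n n (\<lambda>(i, j). A $$ (i, j) - A $$ (i, n) * A $$ (n, j) / A $$ (n, n))) x"
proof -
  let ?a = "A $$ (n, n)" and ?s = "\<Sum>i<n. A $$ (n, i) * x i"
  have "quad (Suc n) A x = quad n A x + 2 * x n * ?s + ?a * (x n)\<^sup>2"
    unfolding quad_def
    by (simp add: sum.distrib sum_distrib_left power2_eq_square sym algebra_simps)
  moreover have "quad n (mat n n (\<lambda>(i, j). A $$ (i, j) - A $$ (i, n) * A $$ (n, j) / ?a)) x
      = quad n A x - ?s\<^sup>2 / ?a"
    unfolding quad_def power2_eq_square sum_product sum_divide_distrib sum_subtractf[symmetric]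
    by (intro sum.cong refl) (auto simp: sym field_simps nz)
  moreover have "?a * (x n + ?s / ?a)\<^sup>2 = ?a * (x n)\<^sup>2 + 2 * x n * ?s + ?s\<^sup>2 / ?a"
    using nz by (simp add: power2_sum power_divide field_simps power2_eq_square)
  ultimately show ?thesis by simp
qed

text \<open>The corner is the value of the form at the last basis vector. For the complement, a
  point \<open>x\<close> is extended by the last coordinate that makes the completed square
  vanish.\<close>

lemma pos_def_schur_complement:
  assumes pd: "pos_def_mat (Suc n) A"
  shows "A $$ (n, n) > 0"
    and "pos_def_mat n (mat n n (\<lambda>(i, j). A $$ (i, j) - A $$ (i, n) * A $$ (n, j) / A $$ (n, n)))"
proof -
  note A = pos_def_mat_carrier[OF pd]
  have sym: "A $$ (i, j) = A $$ (j, i)" if "i < Suc n" "j < Suc n" for i j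
    using pos_def_mat_transpose[OF pd] A that by (metis carrier_matD index_transpose_mat(1))
  have "quad (Suc n) A (\<lambda>i. of_bool (i = n)) > 0"
    using pos_def_mat_quad_pos[OF pd, of n "\<lambda>i. of_bool (i = n)"] by simp
  then show a: "A $$ (n, n) > 0" by (simp add: quad_def)
  show "pos_def_mat n (mat n n (\<lambda>(i, j). A $$ (i, j) - A $$ (i, n) * A $$ (n, j) / A $$ (n, n)))"
    (is "pos_def_mat n ?S")
    unfolding pos_def_mat_iff_quad
  proof (intro conjI allI impI)
    show "transpose_mat ?S = ?S" using sym by (intro eq_matI) (auto simp: mult.commute)
    fix x :: "nat \<Rightarrow> real" assume "\<exists>i<n. x i \<noteq> 0"
    then obtain i where i: "i < n" "x i \<noteq> 0" by blast
    define y where "y = x(n := - (\<Sum>i<n. A $$ (n, i) * x i) / A $$ (n, n))"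
    have "quad (Suc n) A y > 0" using pos_def_mat_quad_pos[OF pd, of i] i by (simp add: y_def)
    moreover have "quad n ?S y = quad n ?S x" by (rule quad_cong) (simp add: y_def)
    moreover have "(\<Sum>i<n. A $$ (n, i) * y i) = (\<Sum>i<n. A $$ (n, i) * x i)"
      by (intro sum.cong) (auto simp: y_def)
    moreover have "y n + (\<Sum>i<n. A $$ (n, i) * x i) / A $$ (n, n) = 0"
      using a by (simp add: y_def field_simps)
    ultimately show "quad n ?S x > 0"
      using quad_complete_square[of n A y] sym a by simp
  qed simp
qed

lemma pos_def_mat_det_pos: "pos_def_mat d A \<Longrightarrow> det A > 0"
proof (induction d arbitrary: A)
  case 0
  then show ?case using pos_def_mat_carrier by fastforce
next
  case (Suc n)
  note s = pos_def_schur_complement[OF Suc.prems]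
  show ?case
    unfolding det_eq_schur_complement[OF pos_def_mat_carrier[OF Suc.prems] less_imp_neq[OF s(1), symmetric]]
    using s(1) Suc.IH[OF s(2)] by simp
qed

lemma nn_integral_gaussian_real:
  fixes a m :: real
  assumes a: "a > 0"
  shows "(\<integral>\<^sup>+x. ennreal (exp (- a * (x - m)\<^sup>2)) \<partial>lborel) = ennreal (sqrt (pi / a))"
proof -
  \<comment> \<open>This variance makes the exponent of \<open>normal_density\<close> equal to
    \<open>- a * (x - m)\<^sup>2\<close>.\<close>
  define \<sigma> where "\<sigma> = sqrt (1 / (2 * a))"
  have \<sigma>: "\<sigma> > 0" "\<sigma>\<^sup>2 = 1 / (2 * a)" using a by (auto simp: \<sigma>_def)
  have *: "exp (- a * (x - m)\<^sup>2) = sqrt (pi / a) * normal_density m \<sigma> x" for x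
    using a unfolding normal_density_def \<sigma>(2) by (simp add: field_simps real_sqrt_divide)
  have "(\<integral>\<^sup>+x. ennreal (exp (- a * (x - m)\<^sup>2)) \<partial>lborel)
      = (\<integral>\<^sup>+x. ennreal (sqrt (pi / a)) * ennreal (normal_density m \<sigma> x) \<partial>lborel)"
    unfolding * using a by (intro nn_integral_cong ennreal_mult) auto
  also have "\<dots> = ennreal (sqrt (pi / a)) * (\<integral>\<^sup>+x. ennreal (normal_density m \<sigma> x) \<partial>lborel)"
    by (intro nn_integral_cmult) auto
  also have "(\<integral>\<^sup>+x. ennreal (normal_density m \<sigma> x) \<partial>lborel) = 1"
    using integral_normal_density[OF \<sigma>(1)] integrable_normal_density[OF \<sigma>(1)]
    by (subst nn_integral_eq_integral) auto
  finally show ?thesis by simp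
qed

lemma quad_measurable [measurable]:
  "(\<lambda>x. quad d A (\<lambda>i. x i - m i)) \<in> borel_measurable (leb d)"
  unfolding quad_def leb_def by measurable

text \<open>Induction on the dimension, integrating out the last coordinate: it contributes
  \<open>sqrt (pi / (c * a))\<close> for the corner entry \<open>a\<close>, and the Schur complement
  remains. In dimension zero the space is a single point of mass one and the determinant is
  one.\<close>

lemma nn_integral_gaussian:
  assumes c: "c > 0" and pd: "pos_def_mat d A"
  shows "(\<integral>\<^sup>+x. ennreal (exp (- c * quad d A (\<lambda>i. x i - m i))) \<partial>leb d)
    = ennreal (sqrt ((pi / c) ^ d / det A))"
  using pd
proof (induction d arbitrary: A)
  case 0
  then have "A \<in> carrier_mat 0 0" by (rule pos_def_mat_carrier)
  then have "det A = 1" by simp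
  then show ?case
    by (simp add: quad_def leb_def PiM_empty nn_integral_count_space_finite)
next
  case (Suc n)
  note A = pos_def_mat_carrier[OF Suc.prems] and s = pos_def_schur_complement[OF Suc.prems]
  have sym: "A $$ (i, j) = A $$ (j, i)" if "i < Suc n" "j < Suc n" for i j
    using pos_def_mat_transpose[OF Suc.prems] A that by (metis carrier_matD index_transpose_mat(1))
  define a where "a = A $$ (n, n)"
  define S where "S = mat n n (\<lambda>(i, j). A $$ (i, j) - A $$ (i, n) * A $$ (n, j) / a)"
  have a: "a > 0" and pdS: "pos_def_mat n S" using s unfolding a_def S_def by auto
  interpret product_sigma_finite "\<lambda>_::nat. lborel :: real measure" by standard
  have "(\<integral>\<^sup>+x. ennreal (exp (- c * quad (Suc n) A (\<lambda>i. x i - m i))) \<partial>leb (Suc n))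
      = (\<integral>\<^sup>+x. (\<integral>\<^sup>+t. ennreal (exp (- c * quad (Suc n) A (\<lambda>i. (x(n := t)) i - m i))) \<partial>lborel) \<partial>leb n)"
    unfolding leb_def lessThan_Suc using quad_measurable[of "Suc n" A m]
    by (subst product_nn_integral_insert) (auto simp: leb_def lessThan_Suc)
  also have "\<dots> = (\<integral>\<^sup>+x. ennreal (exp (- c * quad n S (\<lambda>i. x i - m i))) * ennreal (sqrt (pi / (c * a))) \<partial>leb n)"
  proof (rule nn_integral_cong)
    fix x :: "nat \<Rightarrow> real"
    \<comment> \<open>Completing the square moves the centre of the inner Gaussian to
      \<open>m n - b\<close>. The centre depends on \<open>x\<close>, but the mass of that Gaussian
      does not.\<close>
    define b where "b = (\<Sum>i<n. A $$ (n, i) * (x i - m i)) / a"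
    have "quad (Suc n) A (\<lambda>i. (x(n := t)) i - m i) = a * (t - (m n - b))\<^sup>2 + quad n S (\<lambda>i. x i - m i)" for t
    proof -
      have "(\<Sum>i<n. A $$ (n, i) * ((x(n := t)) i - m i)) = (\<Sum>i<n. A $$ (n, i) * (x i - m i))"
        by (intro sum.cong) auto
      moreover have "quad n S (\<lambda>i. (x(n := t)) i - m i) = quad n S (\<lambda>i. x i - m i)"
        by (rule quad_cong) auto
      ultimately show ?thesis
        using quad_complete_square[of n A "\<lambda>i. (x(n := t)) i - m i"] sym s(1)
        by (simp add: a_def S_def b_def algebra_simps)
    qed
    then have "ennreal (exp (- c * quad (Suc n) A (\<lambda>i. (x(n := t)) i - m i)))
        = ennreal (exp (- c * quad n S (\<lambda>i. x i - m i))) * ennreal (exp (- (c * a) * (t - (m n - b))\<^sup>2))" for t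
      by (simp add: ennreal_mult[symmetric] exp_add[symmetric] algebra_simps)
    then show "(\<integral>\<^sup>+t. ennreal (exp (- c * quad (Suc n) A (\<lambda>i. (x(n := t)) i - m i))) \<partial>lborel)
        = ennreal (exp (- c * quad n S (\<lambda>i. x i - m i))) * ennreal (sqrt (pi / (c * a)))"
      using nn_integral_gaussian_real[of "c * a" "m n - b"] a c by (simp add: nn_integral_cmult)
  qed
  also have "\<dots> = ennreal (sqrt ((pi / c) ^ n / det S)) * ennreal (sqrt (pi / (c * a)))"
    by (subst nn_integral_multc) (use Suc.IH[OF pdS] in auto)
  also have "\<dots> = ennreal (sqrt ((pi / c) ^ n / det S * (pi / (c * a))))"
    using pos_def_mat_det_pos[OF pdS] c a by (simp only: real_sqrt_mult) (simp add: ennreal_mult)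
  also have "(pi / c) ^ n / det S * (pi / (c * a)) = (pi / c) ^ Suc n / det A"
    using det_eq_schur_complement[OF A] a unfolding S_def a_def by (simp add: ac_simps)
  finally show ?case .
qed

lemma gaussian_has_bochner_integral:
  assumes c: "c > 0" and pd: "pos_def_mat d A"
  shows "has_bochner_integral (leb d) (\<lambda>x. exp (- c * quad d A (\<lambda>i. x i - m i)))
    (sqrt ((pi / c) ^ d / det A))"
  using pos_def_mat_det_pos[OF pd] c
  by (intro has_bochner_integral_nn_integral nn_integral_gaussian[OF c pd]) auto

section \<open>Taylor expansion\<close>

text \<open>The whole line through \<open>x\<close> in direction \<open>h\<close>, since
  \<open>t\<close> is any real. The restriction keeps its points in \<open>eucl d\<close>, whatever
  \<open>h\<close> is from index \<open>d\<close> on.\<close>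

definition segment :: "nat \<Rightarrow> (nat \<Rightarrow> real) \<Rightarrow> (nat \<Rightarrow> real) \<Rightarrow> real \<Rightarrow> nat \<Rightarrow> real" where
  "segment d x h t = (\<lambda>i\<in>{..<d}. x i + t * h i)"

lemma segment_in_eucl [simp]: "segment d x h t \<in> eucl d"
  unfolding segment_def eucl_def by auto

lemma segment_0: "x \<in> eucl d \<Longrightarrow> segment d x h 0 = x"
  unfolding segment_def eucl_def by (auto simp: PiE_iff extensional_def fun_eq_iff)

lemma segment_add: "segment d (segment d x h t) h s = segment d x h (s + t)"
  unfolding segment_def by (auto simp: fun_eq_iff algebra_simps)

lemma fun_upd_in_eucl: "x \<in> eucl d \<Longrightarrow> i < d \<Longrightarrow> x(i := t) \<in> eucl d"
  unfolding eucl_def by (auto simp: PiE_iff extensional_def)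

lemma C_k_on_eucl_continuous: "C_k_on_eucl d k g \<Longrightarrow> continuous_on (eucl d) g"
  by (cases k) auto

lemma C_k_on_eucl_partial: "C_k_on_eucl d (Suc k) g \<Longrightarrow> i < d \<Longrightarrow> C_k_on_eucl d k (partial i g)"
  by simp

lemma has_partial_derivative:
  assumes g: "C_k_on_eucl d (Suc k) g" and i: "i < d" and x: "x \<in> eucl d"
  shows "((\<lambda>t. g (x(i := t))) has_real_derivative partial i g (x(i := u))) (at u)"
proof -
  have "(\<lambda>t. g ((x(i := u))(i := t))) field_differentiable (at ((x(i := u)) i))"
    using bspec[of "eucl d" "\<lambda>x. (\<lambda>t. g (x(i := t))) field_differentiable (at (x i))" "x(i := u)"]
      g i fun_upd_in_eucl[OF x i] by auto
  then show ?thesis unfolding partial_def by (simp add: field_differentiable_derivI)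
qed

text \<open>The chain rule from continuous partial derivatives: in \<open>z m s\<close> only the
  first \<open>m\<close> coordinates are moved, the increment from \<open>z m s\<close> to
  \<open>z (Suc m) s\<close> is treated by the mean value theorem, and induction on \<open>m\<close>
  adds the increments up.\<close>

lemma has_derivative_along_segment_0:
  assumes g: "C_k_on_eucl d (Suc k) g" and x: "x \<in> eucl d"
  shows "((\<lambda>t. g (segment d x h t)) has_real_derivative (\<Sum>i<d. h i * partial i g x)) (at 0)"
proof -
  define z where "z m s = (\<lambda>i\<in>{..<d}. if i < m then x i + s * h i else x i)" for m s
  have z_eucl: "z m s \<in> eucl d" for m s unfolding z_def eucl_def by auto
  have z0: "z m 0 = x" for m
    using x unfolding z_def eucl_def by (auto simp: PiE_iff extensional_def fun_eq_iff)
  have "((\<lambda>s. g (z m s)) has_real_derivative (\<Sum>i<m. h i * partial i g x)) (at 0)" if "m \<le> d" for m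
    using that
  proof (induction m)
    case 0
    have "z 0 s = x" for s
      using x unfolding z_def eucl_def by (auto simp: PiE_iff extensional_def fun_eq_iff)
    then show ?case by simp
  next
    case (Suc m)
    then have m: "m < d" by simp
    define D where "D s = g (z (Suc m) s) - g (z m s)" for s
    \<comment> \<open>The sign of \<open>s * h m\<close> decides the order of the end points in the
      mean value theorem, hence the three cases.\<close>
    have "\<exists>\<xi>. \<bar>\<xi> - x m\<bar> \<le> \<bar>s * h m\<bar> \<and> D s = s * h m * partial m g ((z m s)(m := \<xi>))" for s
    proof -
      let ?\<phi> = "\<lambda>\<tau>. g ((z m s)(m := \<tau>))"
      have der: "(?\<phi> has_real_derivative partial m g ((z m s)(m := \<tau>))) (at \<tau>)" for \<tau>
        using has_partial_derivative[OF g m z_eucl] .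
      have ends: "z (Suc m) s = (z m s)(m := x m + s * h m)" "z m s = (z m s)(m := x m)"
        using m unfolding z_def by (auto simp: fun_eq_iff)
      consider "s * h m = 0" | "s * h m > 0" | "s * h m < 0" by linarith
      then show ?thesis
      proof cases
        case 1
        then have "z (Suc m) s = z m s" using ends by (metis add.right_neutral)
        then show ?thesis unfolding D_def using 1 by (intro exI[of _ "x m"]) simp
      next
        case 2
        then obtain \<xi> where "\<xi> > x m" "\<xi> < x m + s * h m"
          "?\<phi> (x m + s * h m) - ?\<phi> (x m) = (x m + s * h m - x m) * partial m g ((z m s)(m := \<xi>))"
          using MVT2[of "x m" "x m + s * h m" ?\<phi>, OF _ der] by auto
        then show ?thesis unfolding D_def using ends by (intro exI[of _ \<xi>]) auto
      next
        case 3
        then obtain \<xi> where "\<xi> < x m" "\<xi> > x m + s * h m"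
          "?\<phi> (x m) - ?\<phi> (x m + s * h m) = (x m - (x m + s * h m)) * partial m g ((z m s)(m := \<xi>))"
          using MVT2[of "x m + s * h m" "x m" ?\<phi>, OF _ der] by auto
        then show ?thesis unfolding D_def using ends by (intro exI[of _ \<xi>]) auto
      qed
    qed
    then obtain \<xi> where \<xi>: "\<bar>\<xi> s - x m\<bar> \<le> \<bar>s * h m\<bar>"
        "D s = s * h m * partial m g ((z m s)(m := \<xi> s))" for s by metis
    have "continuous_on (eucl d) (partial m g)"
      using C_k_on_eucl_continuous[OF C_k_on_eucl_partial[OF g m]] .
    \<comment> \<open>Both the base point and the intermediate coordinate move with
      \<open>s\<close>, so continuity is established jointly in the pair.\<close>
    moreover have "continuous_on UNIV (\<lambda>p. (z m (fst p))(m := snd p))"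
    proof (rule continuous_on_coordinatewise_then_product)
      fix i
      consider "i = m" | "i \<noteq> m" "i < m" | "i \<noteq> m" "i < d" "\<not> i < m" | "i \<noteq> m" "\<not> i < d" by linarith
      then show "continuous_on UNIV (\<lambda>p. ((z m (fst p))(m := snd p)) i)"
        using m by cases (auto simp: z_def intro!: continuous_intros)
    qed
    ultimately have "continuous_on UNIV (\<lambda>p. partial m g ((z m (fst p))(m := snd p)))"
      by (rule continuous_on_compose2) (auto intro: fun_upd_in_eucl z_eucl m)
    then have "isCont (\<lambda>p. partial m g ((z m (fst p))(m := snd p))) (0, x m)"
      by (simp add: continuous_on_eq_continuous_at)
    moreover have "(\<xi> \<longlongrightarrow> x m) (at 0)"
    proof (rule LIM_zero_cancel, rule Lim_null_comparison)
      show "\<forall>\<^sub>F s in at 0. norm (\<xi> s - x m) \<le> \<bar>s * h m\<bar>" using \<xi>(1) by simp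
      show "((\<lambda>s. \<bar>s * h m\<bar>) \<longlongrightarrow> 0) (at 0)" by (auto intro!: tendsto_eq_intros)
    qed
    then have "((\<lambda>s. (s, \<xi> s)) \<longlongrightarrow> (0, x m)) (at 0)"
      by (intro tendsto_Pair tendsto_ident_at)
    ultimately have "((\<lambda>s. partial m g ((z m s)(m := \<xi> s))) \<longlongrightarrow> partial m g ((z m 0)(m := x m))) (at 0)"
      using isCont_tendsto_compose[of "(0, x m)" "\<lambda>p. partial m g ((z m (fst p))(m := snd p))"
          "\<lambda>s. (s, \<xi> s)" "at 0"] by simp
    then have lim: "((\<lambda>s. partial m g ((z m s)(m := \<xi> s))) \<longlongrightarrow> partial m g x) (at 0)"
      by (simp add: z0)
    have "(D has_real_derivative h m * partial m g x) (at 0)"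
      unfolding DERIV_def
    proof (rule Lim_transform_eventually)
      show "((\<lambda>s. h m * partial m g ((z m s)(m := \<xi> s))) \<longlongrightarrow> h m * partial m g x) (at 0)"
        using lim by (rule tendsto_mult_left)
      show "\<forall>\<^sub>F s in at 0. h m * partial m g ((z m s)(m := \<xi> s)) = (D (0 + s) - D 0) / s"
        unfolding eventually_at_filter using \<xi>(2) by (simp add: D_def z0)
    qed
    from DERIV_add[OF Suc.IH this] Suc.prems show ?case by (simp add: D_def)
  qed
  moreover have "z d = segment d x h" by (auto simp: z_def segment_def fun_eq_iff)
  ultimately show ?thesis by (metis order_refl)
qed

text \<open>The derivative at \<open>t\<close> is the one at zero for the line restarted at
  \<open>segment d x h t\<close>.\<close>

lemma has_derivative_along_segment:
  assumes g: "C_k_on_eucl d (Suc k) g"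
  shows "((\<lambda>t. g (segment d x h t)) has_real_derivative
    (\<Sum>i<d. h i * partial i g (segment d x h t))) (at t)"
  using has_derivative_along_segment_0[OF g, of "segment d x h t" h]
    DERIV_shift[of "\<lambda>t. g (segment d x h t)" _ 0 t] by (simp add: segment_add)

text \<open>Maclaurin's formula for \<open>g\<close> along the line, where the successive
  derivatives are iterated sums of partial derivatives. The position of \<open>t\<close> stays open
  because the third derivative will be bounded on all of \<open>eucl d\<close>.\<close>

lemma taylor_along_segment:
  assumes g: "C_k_on_eucl d 3 g" and x: "x \<in> eucl d"
  obtains t where "g (segment d x h 1) = g x + (\<Sum>i<d. h i * partial i g x)
      + quad d (hessian d g x) h / 2 + D3 d g (segment d x h t) h h h / 6"
proof -
  have C3: "C_k_on_eucl d (Suc 2) g" using g by (simp add: numeral_3_eq_3 numeral_2_eq_2)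
  have C2: "C_k_on_eucl d (Suc 1) (partial i g)" if "i < d" for i
    using C_k_on_eucl_partial[OF C3 that] by (simp add: numeral_2_eq_2)
  have C1: "C_k_on_eucl d (Suc 0) (partial j (partial i g))" if "i < d" "j < d" for i j
    using C_k_on_eucl_partial[OF C2[OF that(1)] that(2)] by simp
  define f where "f n t = (let s = segment d x h t in
    if n = 0 then g s
    else if n = 1 then (\<Sum>i<d. h i * partial i g s)
    else if n = 2 then (\<Sum>i<d. h i * (\<Sum>j<d. h j * partial j (partial i g) s))
    else (\<Sum>i<d. h i * (\<Sum>j<d. h j * (\<Sum>k<d. h k * partial k (partial j (partial i g)) s))))"
    for n :: nat and t
  have f: "f 0 = (\<lambda>t. g (segment d x h t))"
    "f 1 = (\<lambda>t. \<Sum>i<d. h i * partial i g (segment d x h t))"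
    "f 2 = (\<lambda>t. \<Sum>i<d. h i * (\<Sum>j<d. h j * partial j (partial i g) (segment d x h t)))"
    "f 3 = (\<lambda>t. \<Sum>i<d. h i * (\<Sum>j<d. h j * (\<Sum>k<d. h k * partial k (partial j (partial i g)) (segment d x h t))))"
    by (auto simp: f_def fun_eq_iff Let_def)
  have "(f n has_real_derivative f (Suc n) t) (at t)" if "n < 3" for n t
  proof -
    consider "n = 0" | "n = 1" | "n = 2" using \<open>n < 3\<close> by linarith
    then show ?thesis
    proof cases
      case 1
      then have "Suc n = 1" by simp
      with 1 show ?thesis using has_derivative_along_segment[OF C3] by (simp only: f)
    next
      case 2
      then have "Suc n = 2" by simp
      with 2 show ?thesis
        by (simp only: f) (intro DERIV_sum DERIV_cmult has_derivative_along_segment[OF C2]; simp)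
    next
      case 3
      then have "Suc n = 3" by simp
      with 3 show ?thesis
        by (simp only: f) (intro DERIV_sum DERIV_cmult has_derivative_along_segment[OF C1]; simp)
    qed
  qed
  then obtain t where "f 0 1 = (\<Sum>m<3. f m 0 / fact m * 1 ^ m) + f 3 t / fact 3 * 1 ^ 3"
    using Maclaurin2[of 1 f "f 0" 3] by auto
  then have "g (segment d x h 1) = f 0 0 + f 1 0 + f 2 0 / 2 + f 3 t / 6"
    by (simp add: numeral_3_eq_3 numeral_2_eq_2 f_def)
  moreover have "f 0 0 = g x" "f 1 0 = (\<Sum>i<d. h i * partial i g x)"
    using segment_0[OF x] by (simp_all add: f_def)
  \<comment> \<open>Each differentiation puts its index outermost in \<open>partial\<close> but
    innermost in the sums of \<open>f\<close>. Swapping the sums restores the order used in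
    \<open>hessian\<close>, and below the one used in \<open>D3\<close>.\<close>
  moreover have "f 2 0 = quad d (hessian d g x) h"
    using segment_0[OF x] unfolding f_def quad_def hessian_def
    by (subst sum.swap) (simp add: sum_distrib_left ac_simps)
  moreover have "f 3 t = D3 d g (segment d x h t) h h h"
  proof -
    let ?s = "segment d x h t"
    have "f 3 t = (\<Sum>i<d. \<Sum>j<d. \<Sum>k<d. partial k (partial j (partial i g)) ?s * h k * h j * h i)"
      unfolding f_def by (simp add: sum_distrib_left ac_simps)
    also have "\<dots> = (\<Sum>i<d. \<Sum>k<d. \<Sum>j<d. partial k (partial j (partial i g)) ?s * h k * h j * h i)"
      by (intro sum.cong refl sum.swap)
    also have "\<dots> = (\<Sum>k<d. \<Sum>i<d. \<Sum>j<d. partial k (partial j (partial i g)) ?s * h k * h j * h i)"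
      by (rule sum.swap)
    also have "\<dots> = (\<Sum>k<d. \<Sum>j<d. \<Sum>i<d. partial k (partial j (partial i g)) ?s * h k * h j * h i)"
      by (intro sum.cong refl sum.swap)
    finally show ?thesis unfolding D3_def .
  qed
  ultimately show thesis using that by simp
qed

text \<open>\<open>D3\<close> is homogeneous of degree three on the diagonal, so the supremum is
  compared at \<open>h\<close> divided by its norm. If the norm is zero, \<open>h\<close> vanishes
  on the first \<open>d\<close> coordinates.\<close>

lemma abs_D3_le_D3_norm:
  assumes pd: "pos_def_mat d S"
  shows "\<bar>D3 d g x h h h\<bar> \<le> D3_norm d S g x * (mat_norm d S h) ^ 3"
proof (cases "mat_norm d S h = 0")
  case True
  have "h i = 0" if "i < d" for i
    using pos_def_mat_quad_pos[OF pos_def_mat_inv_mat[OF pd] that, of h]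
      mat_norm_power2[OF pd, of h] True by auto
  then show ?thesis using True by (simp add: D3_def)
next
  case False
  let ?N = "mat_norm d S h"
  have N: "?N > 0" using False L2_set_nonneg unfolding mat_norm_def by (metis order_le_less)
  let ?T = "{\<bar>D3 d g x h1 h2 h3\<bar> | h1 h2 h3.
     h1 \<in> eucl d \<and> h2 \<in> eucl d \<and> h3 \<in> eucl d \<and>
     mat_norm d S h1 \<le> 1 \<and> mat_norm d S h2 \<le> 1 \<and> mat_norm d S h3 \<le> 1}"
  obtain b where b: "\<And>h i. mat_norm d S h \<le> 1 \<Longrightarrow> i < d \<Longrightarrow> \<bar>h i\<bar> \<le> b"
    using mat_norm_le_one_imp_bounded[OF pd] by blast
  have "bdd_above ?T"
  proof (rule bdd_aboveI, safe)
    fix h1 h2 h3 assume h: "mat_norm d S h1 \<le> 1" "mat_norm d S h2 \<le> 1" "mat_norm d S h3 \<le> 1"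
    show "\<bar>D3 d g x h1 h2 h3\<bar>
      \<le> (\<Sum>i<d. \<Sum>j<d. \<Sum>k<d. \<bar>partial i (partial j (partial k g)) x\<bar> * b * b * b)"
      unfolding D3_def
    proof (intro order_trans[OF sum_abs] sum_mono)
      fix i j k assume "i \<in> {..<d}" "j \<in> {..<d}" "k \<in> {..<d}"
      then have "\<bar>h1 i\<bar> \<le> b" "\<bar>h2 j\<bar> \<le> b" "\<bar>h3 k\<bar> \<le> b" using b h by auto
      moreover from this have "0 \<le> b" by linarith
      ultimately show "\<bar>partial i (partial j (partial k g)) x * h1 i * h2 j * h3 k\<bar>
        \<le> \<bar>partial i (partial j (partial k g)) x\<bar> * b * b * b"
        by (simp add: abs_mult mult_mono)
    qed
  qed
  moreover define u where "u = (\<lambda>i\<in>{..<d}. h i / ?N)"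
  have "mat_norm d S u = 1"
  proof -
    have "quad d (inv_mat S) u = quad d (inv_mat S) (\<lambda>i. (1 / ?N) * h i)"
      by (rule quad_cong) (simp add: u_def)
    also have "\<dots> = 1"
      unfolding quad_scale mat_norm_power2[OF pd, symmetric] using N by (simp add: power_divide)
    finally show ?thesis unfolding mat_norm_eq_sqrt_quad[OF pd] by simp
  qed
  moreover have "u \<in> eucl d" unfolding u_def eucl_def by auto
  ultimately have "\<bar>D3 d g x u u u\<bar> \<le> D3_norm d S g x"
    unfolding D3_norm_def by (intro cSup_upper) (blast intro: order_eq_refl)+
  moreover have "D3 d g x h h h = ?N ^ 3 * D3 d g x u u u"
    unfolding D3_def sum_distrib_left
    by (intro sum.cong refl) (use N in \<open>simp add: u_def power3_eq_cube\<close>)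
  ultimately show ?thesis using N by (simp add: abs_mult mult.commute)
qed

section \<open>Derivatives of a linear combination plus a constant, the form of
  \<open>I\<close>\<close>

lemma partial_linear:
  assumes g1: "C_k_on_eucl d (Suc k) g1" and g2: "C_k_on_eucl d (Suc l) g2"
    and f: "\<And>y. y \<in> eucl d \<Longrightarrow> f y = g1 y + c * g2 y + b"
    and i: "i < d" and x: "x \<in> eucl d"
  shows "partial i f x = partial i g1 x + c * partial i g2 x"
proof -
  have "(\<lambda>t. f (x(i := t))) = (\<lambda>t. g1 (x(i := t)) + c * g2 (x(i := t)) + b)"
    using f fun_upd_in_eucl[OF x i] by auto
  moreover have "((\<lambda>t. g1 (x(i := t)) + c * g2 (x(i := t)) + b) has_real_derivative
      partial i g1 (x(i := x i)) + c * partial i g2 (x(i := x i)) + 0) (at (x i))"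
    by (intro DERIV_add DERIV_cmult DERIV_const has_partial_derivative[OF g1 i x] has_partial_derivative[OF g2 i x])
  ultimately show ?thesis unfolding partial_def[of i f] by (simp add: DERIV_imp_deriv)
qed

lemma hessian_linear:
  assumes g1: "C_k_on_eucl d (Suc (Suc k)) g1" and g2: "C_k_on_eucl d (Suc (Suc l)) g2"
    and f: "\<And>y. y \<in> eucl d \<Longrightarrow> f y = g1 y + c * g2 y + b"
    and x: "x \<in> eucl d"
  shows "hessian d f x = hessian d g1 x + c \<cdot>\<^sub>m hessian d g2 x"
proof (rule eq_matI)
  fix i j assume "i < dim_row (hessian d g1 x + c \<cdot>\<^sub>m hessian d g2 x)" "j < dim_col (hessian d g1 x + c \<cdot>\<^sub>m hessian d g2 x)"
  then have ij: "i < d" "j < d" by (auto simp: hessian_def)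
  have "partial j f y = partial j g1 y + c * partial j g2 y + 0" if "y \<in> eucl d" for y
    using partial_linear[OF g1 g2 f ij(2) that] by simp
  from partial_linear[OF C_k_on_eucl_partial[OF g1 ij(2)] C_k_on_eucl_partial[OF g2 ij(2)] this ij(1) x]
  show "hessian d f x $$ (i, j) = (hessian d g1 x + c \<cdot>\<^sub>m hessian d g2 x) $$ (i, j)"
    using ij by (simp add: hessian_def)
qed (auto simp: hessian_def)

section \<open>Densities and total variation\<close>

text \<open>Composing with the restriction to \<open>{..<d}\<close> makes \<open>g\<close>
  continuous on all functions, whose Borel sets are those of the countable product. The identity on
  \<open>leb d\<close> is measurable into this product, as the coordinates from \<open>d\<close> on
  are constantly \<open>undefined\<close>.\<close>

lemma borel_measurable_leb_continuous:
  assumes g: "continuous_on (eucl d) g"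
  shows "g \<in> borel_measurable (leb d)"
proof -
  have "continuous_on UNIV (\<lambda>x. restrict x {..<d} :: nat \<Rightarrow> real)"
  proof (rule continuous_on_coordinatewise_then_product)
    show "continuous_on UNIV (\<lambda>x. restrict x {..<d} i :: real)" for i
      by (cases "i < d") (auto intro: continuous_intros)
  qed
  then have "continuous_on UNIV (\<lambda>x. g (restrict x {..<d}))"
    by (rule continuous_on_compose2[OF g]) (simp add: eucl_def image_subset_iff)
  then have "(\<lambda>x. g (restrict x {..<d})) \<in> borel_measurable borel"
    by (rule borel_measurable_continuous_onI)
  moreover have "(\<lambda>x. x) \<in> measurable (leb d) borel"
  proof -
    have "(\<lambda>x. x i) \<in> borel_measurable (leb d)" for i
    proof (cases "i < d")
      case False
      then have "(\<lambda>x. x i) \<in> borel_measurable (leb d) \<longleftrightarrow> (\<lambda>_. undefined :: real) \<in> borel_measurable (leb d)"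
        unfolding leb_def by (intro measurable_cong) (auto simp: space_PiM PiE_iff extensional_def)
      then show ?thesis by simp
    qed (auto simp: leb_def)
    then have "(\<lambda>x. x) \<in> measurable (leb d) (\<Pi>\<^sub>M i\<in>UNIV. borel)"
      by (intro measurable_PiM_single') (auto simp: PiE_def)
    then show ?thesis by (simp cong: measurable_cong_sets add: sets_PiM_equal_borel)
  qed
  ultimately have "(\<lambda>x. g (restrict x {..<d})) \<in> borel_measurable (leb d)"
    by (rule measurable_compose[rotated])
  moreover have "g (restrict x {..<d}) = g x" if "x \<in> space (leb d)" for x
    using that unfolding leb_def space_PiM by simp
  ultimately show ?thesis by (simp cong: measurable_cong)
qed

lemma measure_density_eq_integral:
  fixes h :: "'a \<Rightarrow> real"
  assumes h: "integrable M h" "\<And>x. h x \<ge> 0" and A: "A \<in> sets M"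
  shows "measure (density M (\<lambda>x. ennreal (h x))) A = (\<integral>x. indicator A x * h x \<partial>M)"
proof -
  have [measurable]: "h \<in> borel_measurable M" "A \<in> sets M" using h A by auto
  have i: "integrable M (\<lambda>x. indicator A x * h x)"
    using integrable_mult_indicator[OF A h(1)] by simp
  have "emeasure (density M (\<lambda>x. ennreal (h x))) A = (\<integral>\<^sup>+x. ennreal (h x) * indicator A x \<partial>M)"
    by (rule emeasure_density) auto
  also have "\<dots> = (\<integral>\<^sup>+x. ennreal (indicator A x * h x) \<partial>M)"
    by (intro nn_integral_cong) (auto simp: indicator_def)
  also have "\<dots> = ennreal (\<integral>x. indicator A x * h x \<partial>M)"
    using i h by (intro nn_integral_eq_integral) auto
  finally show ?thesis using h(2) unfolding measure_def
    by (simp add: enn2real_ennreal integral_nonneg_AE)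
qed

text \<open>With \<open>F\<close> and \<open>G\<close> the unnormalised masses of \<open>A\<close>,
  the difference is \<open>(F / Z) * ((N - Z) / N) + (F - G) / N\<close>. Each summand is at most
  the \<open>L\<^sup>1\<close> distance over \<open>N\<close>, hence the factor 2, and the bound is
  relative to the mass of \<open>g\<close> alone.\<close>

lemma measure_normalized_density_diff_le:
  fixes f g :: "'a \<Rightarrow> real"
  assumes f: "integrable M f" "\<And>x. f x \<ge> 0" and g: "integrable M g" "\<And>x. g x \<ge> 0"
    and pos: "(\<integral>x. f x \<partial>M) > 0" "(\<integral>x. g x \<partial>M) > 0" and A: "A \<in> sets M"
  shows "\<bar>measure (density M (\<lambda>x. ennreal (f x / (\<integral>x. f x \<partial>M)))) A
    - measure (density M (\<lambda>x. ennreal (g x / (\<integral>x. g x \<partial>M)))) A\<bar>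
    \<le> 2 * (\<integral>x. \<bar>f x - g x\<bar> \<partial>M) / (\<integral>x. g x \<partial>M)"
proof -
  define Z N D where "Z = (\<integral>x. f x \<partial>M)" and "N = (\<integral>x. g x \<partial>M)" and "D = (\<integral>x. \<bar>f x - g x\<bar> \<partial>M)"
  define F G where "F = (\<integral>x. indicator A x * f x \<partial>M)" and "G = (\<integral>x. indicator A x * g x \<partial>M)"
  have fA: "integrable M (\<lambda>x. indicator A x * f x)" and gA: "integrable M (\<lambda>x. indicator A x * g x)"
    using integrable_mult_indicator[OF A f(1)] integrable_mult_indicator[OF A g(1)] by simp_all
  have "measure (density M (\<lambda>x. ennreal (f x / Z))) A = F / Z"
    using f pos A unfolding F_def Z_def by (subst measure_density_eq_integral) auto
  moreover have "measure (density M (\<lambda>x. ennreal (g x / N))) A = G / N"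
    using g pos A unfolding G_def N_def by (subst measure_density_eq_integral) auto
  moreover have "\<bar>F / Z - G / N\<bar> \<le> 2 * D / N"
  proof -
    have Z: "Z > 0" and N: "N > 0" using pos by (auto simp: Z_def N_def)
    have FZ: "0 \<le> F" "F \<le> Z"
      unfolding F_def Z_def using f fA
      by (auto intro!: integral_nonneg_AE integral_mono simp: indicator_def)
    have di: "integrable M (\<lambda>x. \<bar>f x - g x\<bar>)" using f g by auto
    have ZN: "\<bar>Z - N\<bar> \<le> D"
      unfolding Z_def N_def D_def using f g integral_abs_bound[of M "\<lambda>x. f x - g x"] by simp
    have FG: "\<bar>F - G\<bar> \<le> D"
    proof -
      have ai: "integrable M (\<lambda>x. \<bar>indicator A x * f x - indicator A x * g x\<bar>)"
        using fA gA by auto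
      have "\<bar>F - G\<bar> \<le> (\<integral>x. \<bar>indicator A x * f x - indicator A x * g x\<bar> \<partial>M)"
        unfolding F_def G_def
        using fA gA integral_abs_bound[of M "\<lambda>x. indicator A x * f x - indicator A x * g x"] by simp
      also have "\<dots> \<le> D" unfolding D_def
        by (rule integral_mono[OF ai di]) (auto simp: indicator_def)
      finally show ?thesis .
    qed
    define X where "X = (F / Z) * ((N - Z) / N)"
    define Y where "Y = (F - G) / N"
    have XY: "F / Z - G / N = X + Y" unfolding X_def Y_def using Z N by (simp add: field_simps)
    have "\<bar>F / Z\<bar> \<le> 1" using FZ Z by simp
    from mult_right_mono[OF this, of "\<bar>N - Z\<bar> / N"] have "\<bar>X\<bar> \<le> \<bar>Z - N\<bar> / N"
      using N unfolding X_def by (simp add: abs_mult abs_divide abs_minus_commute)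
    moreover have "\<bar>Y\<bar> = \<bar>F - G\<bar> / N" using N by (simp add: Y_def)
    ultimately have "\<bar>X + Y\<bar> \<le> D / N + D / N"
      using N divide_right_mono[of "\<bar>Z - N\<bar>" D N] divide_right_mono[of "\<bar>F - G\<bar>" D N] ZN FG
      by linarith
    with XY have "\<bar>F / Z - G / N\<bar> \<le> D / N + D / N" by simp
    then show ?thesis by simp
  qed
  ultimately show ?thesis unfolding Z_def N_def D_def by simp
qed

section \<open>Scalar estimates\<close>

text \<open>The inequality \<open>s \<le> exp (s - 1)\<close> at \<open>s = r\<^sup>2 / D\<close> is
  raised to the power \<open>3 / 2\<close>. It is sharp at \<open>r\<^sup>2 = D\<close>, the mean
  squared length of a standard Gaussian vector in dimension \<open>D\<close>.\<close>

lemma power3_le_powr_exp: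
  fixes r D :: real
  assumes r: "r \<ge> 0" and D: "D > 0"
  shows "r ^ 3 \<le> D powr (3 / 2) * exp (3 / 2 * (r\<^sup>2 / D - 1))"
proof -
  have "r\<^sup>2 / D \<le> exp (r\<^sup>2 / D - 1)" using exp_ge_add_one_self[of "r\<^sup>2 / D - 1"] by simp
  then have "r\<^sup>2 \<le> D * exp (r\<^sup>2 / D - 1)" using D by (simp add: field_simps)
  then have "(r\<^sup>2) powr (3 / 2) \<le> (D * exp (r\<^sup>2 / D - 1)) powr (3 / 2)"
    by (intro powr_mono2) auto
  also have "\<dots> = D powr (3 / 2) * exp (3 / 2 * (r\<^sup>2 / D - 1))"
    using D by (simp add: powr_mult) (simp add: powr_def)
  also have "(r\<^sup>2) powr (3 / 2) = r ^ 3"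
  proof (cases "r = 0")
    case False
    then have "r > 0" using r by simp
    then have "(r\<^sup>2) powr (3 / 2) = (r powr 2) powr (3 / 2)" by simp
    also have "\<dots> = r powr 3" unfolding powr_powr by simp
    finally show ?thesis using \<open>r > 0\<close> by simp
  qed simp
  finally show ?thesis .
qed

text \<open>Factoring out \<open>exp (- a)\<close> leaves \<open>\<bar>exp (- t) - 1\<bar>\<close>.
  The factor \<open>exp 1\<close> is the price of negative \<open>t\<close>, where
  \<open>exp (- t) \<le> exp 1\<close>.\<close>

lemma abs_exp_diff_le:
  fixes a t :: real
  assumes "\<bar>t\<bar> \<le> 1"
  shows "\<bar>exp (- (a + t)) - exp (- a)\<bar> \<le> exp 1 * \<bar>t\<bar> * exp (- a)"
proof -
  have "\<bar>exp (- t) - 1\<bar> \<le> exp 1 * \<bar>t\<bar>"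
  proof (cases "t \<ge> 0")
    case True
    have "1 - exp (- t) \<le> t" using exp_ge_add_one_self[of "- t"] by simp
    also have "\<dots> \<le> exp 1 * t" using True mult_right_mono[of 1 "exp 1" t] by simp
    finally show ?thesis using True by simp
  next
    case False
    have le: "1 - exp t \<le> - t" using exp_ge_add_one_self[of t] by linarith
    have "exp (- t) - 1 = exp (- t) * (1 - exp t)" by (simp add: algebra_simps exp_minus)
    also have "\<dots> \<le> exp (- t) * (- t)" using le by (intro mult_left_mono) auto
    also have "\<dots> \<le> exp 1 * (- t)" using False assms by (intro mult_right_mono) auto
    finally show ?thesis using False by simp
  qed
  then have "exp (- a) * \<bar>exp (- t) - 1\<bar> \<le> exp (- a) * (exp 1 * \<bar>t\<bar>)" by (intro mult_left_mono) auto
  also have "exp (- a) * \<bar>exp (- t) - 1\<bar> = \<bar>exp (- a) * (exp (- t) - 1)\<bar>" by (simp add: abs_mult)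
  also have "exp (- a) * (exp (- t) - 1) = exp (- (a + t)) - exp (- a)"
    by (simp add: right_diff_distrib exp_add[symmetric])
  finally show ?thesis by (simp add: mult_ac)
qed

text \<open>Inside the ball of radius \<open>b\<close> the exponents differ by at most one; outside it both terms are
  bounded by the wider Gaussian.\<close>

lemma abs_exp_minus_gaussian_le:
  fixes V r b k \<delta> D :: real
  assumes r: "r \<ge> 0" and b: "b > 0" and k: "k = 3 / b ^ 3" and \<delta>: "0 < \<delta>" "\<delta> \<le> 1" and D: "D > 0"
    and lower: "V \<ge> \<delta> / 2 * r\<^sup>2" and near: "\<bar>V - r\<^sup>2 / 2\<bar> \<le> k / 3 * r ^ 3"
  shows "\<bar>exp (- V) - exp (- r\<^sup>2 / 2)\<bar> \<le>
      k / 3 * exp (- 1 / 2) * D powr (3 / 2) * exp (- ((1 - 3 / D) / 2) * r\<^sup>2)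
      + exp (- \<delta> * b\<^sup>2 / 4) * exp (- (\<delta> / 4) * r\<^sup>2)"
proof (cases "r \<le> b")
  case True
  have k0: "k > 0" using k b by simp
  have "k / 3 * r ^ 3 \<le> k / 3 * b ^ 3" using True r k0 by (intro mult_left_mono power_mono) auto
  also have "\<dots> = 1" using b by (simp add: k)
  finally have "\<bar>V - r\<^sup>2 / 2\<bar> \<le> 1" using near by linarith
  from abs_exp_diff_le[OF this, of "r\<^sup>2 / 2"]
  have "\<bar>exp (- V) - exp (- r\<^sup>2 / 2)\<bar> \<le> exp 1 * \<bar>V - r\<^sup>2 / 2\<bar> * exp (- r\<^sup>2 / 2)" by simp
  also have "\<dots> \<le> exp 1 * (k / 3 * (D powr (3 / 2) * exp (3 / 2 * (r\<^sup>2 / D - 1)))) * exp (- r\<^sup>2 / 2)"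
    using order_trans[OF near mult_left_mono[OF power3_le_powr_exp[OF r D], of "k / 3"]] k0
    by (intro mult_right_mono mult_left_mono) auto
  also have "\<dots> = k / 3 * D powr (3 / 2) * exp (1 + 3 / 2 * (r\<^sup>2 / D - 1) + - r\<^sup>2 / 2)"
    by (simp only: exp_add mult_ac)
  \<comment> \<open>The \<open>exp 1\<close> of the difference bound and the
    \<open>exp (- 3 / 2)\<close> of the cube bound leave \<open>exp (- 1 / 2)\<close>; the quadratic
    terms merge into a slightly wider Gaussian.\<close>
  also have "1 + 3 / 2 * (r\<^sup>2 / D - 1) + - r\<^sup>2 / 2 = - 1 / 2 + - ((1 - 3 / D) / 2) * r\<^sup>2"
    using D by (simp add: field_simps)
  finally show ?thesis unfolding exp_add by (simp add: mult_ac add_increasing2)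
next
  case False
  have k0: "k > 0" using k b by simp
  have "b\<^sup>2 \<le> r\<^sup>2" using False b by (intro power_mono) auto
  \<comment> \<open>Half of the decay is spent on the constant
    \<open>exp (- \<delta> * b\<^sup>2 / 4)\<close>; the other half keeps the bound
    integrable.\<close>
  then have le: "- (\<delta> / 2 * r\<^sup>2) \<le> - \<delta> * b\<^sup>2 / 4 + - (\<delta> / 4) * r\<^sup>2"
    using mult_left_mono[of "b\<^sup>2" "r\<^sup>2" \<delta>] \<delta> by (simp add: field_simps)
  have "exp (- V) \<le> exp (- (\<delta> / 2 * r\<^sup>2))" using lower by simp
  moreover have "exp (- r\<^sup>2 / 2) \<le> exp (- (\<delta> / 2 * r\<^sup>2))"
    using mult_right_mono[OF \<delta>(2), of "r\<^sup>2"] by simp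
  ultimately have "\<bar>exp (- V) - exp (- r\<^sup>2 / 2)\<bar> \<le> exp (- (\<delta> / 2 * r\<^sup>2))"
    using exp_ge_zero[of "- V"] exp_ge_zero[of "- r\<^sup>2 / 2"] by linarith
  also have "\<dots> \<le> exp (- \<delta> * b\<^sup>2 / 4 + - (\<delta> / 4) * r\<^sup>2)" using le by (simp only: exp_le_cancel_iff)
  finally show ?thesis unfolding exp_add using k0 by (simp add: add_increasing)
qed

section \<open>Bounds for the normalising constants\<close>

lemma sqrt_power_le_exp:
  fixes x c :: real
  assumes x: "x \<ge> 0" and le: "x \<le> exp c"
  shows "sqrt (x ^ n) \<le> exp (real n * c / 2)"
proof -
  have "x ^ n \<le> exp c ^ n" using assms by (intro power_mono)
  also have "\<dots> = (exp (real n * c / 2))\<^sup>2"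
    by (simp add: exp_of_nat_mult[symmetric] power2_eq_square exp_add[symmetric])
  finally show ?thesis by (simp add: real_le_lsqrt)
qed

text \<open>The inequality \<open>1 + x \<le> exp x\<close> yields the exponent
  \<open>3 * n / (2 * (n - 3))\<close>, which decreases to \<open>3 / 2\<close> and is at most
  \<open>31 / 20\<close> from \<open>n = 100\<close> on.\<close>

lemma gaussian_bulk_le:
  assumes n: "n \<ge> (100 :: nat)"
  shows "sqrt ((1 / (1 - 3 / real n)) ^ n) \<le> exp (31 / 20)"
proof -
  have "1 / (1 - 3 / real n) = 1 + 3 / (real n - 3)" using n by (simp add: field_simps)
  also have "\<dots> \<le> exp (3 / (real n - 3))" by (rule exp_ge_add_one_self)
  finally have "sqrt ((1 / (1 - 3 / real n)) ^ n) \<le> exp (real n * (3 / (real n - 3)) / 2)"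
    using n by (intro sqrt_power_le_exp) (auto simp: field_simps)
  also have "real n * (3 / (real n - 3)) / 2 \<le> 31 / 20" using n by (simp add: field_simps)
  finally show ?thesis by simp
qed

text \<open>The factor \<open>exp (- \<delta> * b\<^sup>2 / 4)\<close> has to beat both the
  normalising constant of the wider Gaussian and \<open>b ^ 3\<close>. The growth condition gives
  \<open>s \<ge> 8 * L * n\<close> for \<open>s = \<delta> * b\<^sup>2\<close> and
  \<open>L = ln (1 / \<delta>)\<close>, and a share \<open>3 / 20 * s\<close> out of
  \<open>s / 4\<close> goes to the normalising constant.\<close>

lemma gaussian_tail_le:
  fixes b \<delta> :: real
  assumes n: "n \<ge> (100 :: nat)" and b: "b > 0" and \<delta>: "0 < \<delta>" "\<delta> \<le> exp (- 1 / 2)"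
    and large: "b\<^sup>2 \<ge> 8 / \<delta> * ln (1 / \<delta>) * real n"
  shows "exp (- \<delta> * b\<^sup>2 / 4) * sqrt ((2 / \<delta>) ^ n) \<le> exp (- 3 / 2) * real n powr (3 / 2) / b ^ 3"
proof -
  define L s where "L = ln (1 / \<delta>)" and "s = \<delta> * b\<^sup>2"
  have expL: "exp L = 1 / \<delta>" using \<delta> by (simp add: L_def)
  have "ln \<delta> \<le> - 1 / 2" using \<delta> by (metis ln_exp ln_le_cancel_iff exp_gt_zero)
  then have L: "L \<ge> 1 / 2" using \<delta> by (simp add: L_def ln_div)
  have s: "s \<ge> 8 * L * real n"
    using large mult_left_mono[OF large, of \<delta>] \<delta> by (simp add: s_def L_def field_simps)
  have nL: "real n * (1 / 2) \<le> real n * L" using L by (intro mult_left_mono) auto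
  have "2 / \<delta> = exp (ln 2 + L)" by (simp add: exp_add expL)
  then have "sqrt ((2 / \<delta>) ^ n) \<le> exp (real n * (ln 2 + L) / 2)"
    using \<delta> by (intro sqrt_power_le_exp) auto
  also have "\<dots> \<le> exp (real n * (7 / 10 + L) / 2)"
    using ln2_le_25_over_36 by (simp add: mult_left_mono)
  \<comment> \<open>By \<open>L \<ge> 1 / 2\<close>, which is the bound on \<open>\<delta>\<close>,
    one has \<open>7 / 20 + L / 2 \<le> 6 / 5 * L\<close>, and \<open>6 / 5 * L * n\<close> is at
    most \<open>3 / 20 * s\<close>.\<close>
  also have "\<dots> \<le> exp (3 / 20 * s)"
    using s nL by (simp add: algebra_simps)
  finally have 1: "exp (- \<delta> * b\<^sup>2 / 4) * sqrt ((2 / \<delta>) ^ n) \<le> exp (- s / 4) * exp (3 / 20 * s)"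
    by (simp add: s_def)
  have "(sqrt s) ^ 3 \<le> real n powr (3 / 2) * exp (3 / 2 * ((sqrt s)\<^sup>2 / real n - 1))"
    using n \<delta> by (intro power3_le_powr_exp) (auto simp: s_def)
  also have "(sqrt s)\<^sup>2 = s" using \<delta> by (simp add: s_def)
  finally have s3: "(sqrt s) ^ 3 \<le> real n powr (3 / 2) * exp (3 / 2 * (s / real n - 1))" .
  have "b\<^sup>2 = s * exp L" using \<delta> by (simp add: s_def expL)
  then have "b = sqrt s * sqrt (exp L)" using b by (metis abs_of_pos real_sqrt_abs real_sqrt_mult)
  also have "sqrt (exp L) = exp (L / 2)"
    by (rule real_sqrt_unique) (auto simp: power2_eq_square exp_add[symmetric])
  finally have "b ^ 3 = (sqrt s) ^ 3 * exp (3 / 2 * L)"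
    by (simp add: power_mult_distrib exp_of_nat_mult[symmetric])
  also have "\<dots> \<le> real n powr (3 / 2) * exp (3 / 2 * (s / real n - 1)) * exp (3 / 2 * L)"
    using s3 by (intro mult_right_mono) auto
  finally have "b ^ 3 \<le> real n powr (3 / 2) * exp (3 / 2 * (s / real n - 1) + 3 / 2 * L)"
    by (simp add: exp_add)
  then have "exp (- s / 4) * exp (3 / 20 * s) * b ^ 3 \<le>
      exp (- s / 4) * exp (3 / 20 * s) * (real n powr (3 / 2) * exp (3 / 2 * (s / real n - 1) + 3 / 2 * L))"
    by (intro mult_left_mono) auto
  also have "\<dots> = real n powr (3 / 2) * exp (- s / 4 + 3 / 20 * s + (3 / 2 * (s / real n - 1) + 3 / 2 * L))"
    by (simp only: exp_add mult_ac)
  \<comment> \<open>The remaining decay \<open>- s / 10\<close> absorbs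
    \<open>3 / 2 * s / n \<le> 3 / 200 * s\<close> and \<open>3 / 2 * L \<le> 3 / 1600 * s\<close>,
    so the constant \<open>- 3 / 2\<close> is left.\<close>
  also have "\<dots> \<le> real n powr (3 / 2) * exp (- 3 / 2)"
  proof -
    have s0: "s \<ge> 0" using \<delta> by (simp add: s_def)
    obtain w where w: "s / real n = w" by blast
    have "w \<le> s / 100" unfolding w[symmetric] using n s0 by (intro divide_left_mono) auto
    moreover have "800 * L \<le> 8 * real n * L" using n L by (intro mult_right_mono) auto
    with s have "800 * L \<le> s" by (simp add: mult_ac)
    ultimately have "- s / 4 + 3 / 20 * s + (3 / 2 * (s / real n - 1) + 3 / 2 * L) \<le> - 3 / 2"
      unfolding w using s0 by argo
    then show ?thesis by (intro mult_left_mono) auto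
  qed
  finally have "exp (- s / 4) * exp (3 / 20 * s) \<le> exp (- 3 / 2) * real n powr (3 / 2) / b ^ 3"
    using b by (simp add: field_simps)
  with 1 show ?thesis by linarith
qed

text \<open>The summands are the constants from the ball, \<open>exp (- 1 / 2)\<close> times
  \<open>exp (31 / 20)\<close>, and from its complement. Divided by \<open>exp 1\<close>, their sum
  is at most \<open>20 / 19 + 2 / 7\<close>, which is below \<open>7 / 5\<close> and hence below
  \<open>sqrt 2\<close>.\<close>

lemma exp_constants_le: "exp (21 / 20) + exp (- 3 / 2) \<le> sqrt 2 * exp (1 :: real)"
proof -
  have "exp (- (1 / 20)) \<ge> 19 / (20 :: real)" using exp_ge_add_one_self[of "- (1 / 20) :: real"] by simp
  then have 1: "exp (1 / 20) \<le> 20 / (19 :: real)" by (simp add: exp_minus field_simps)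
  have "exp (5 / 2) \<ge> 7 / (2 :: real)" using exp_ge_add_one_self[of "5 / 2 :: real"] by simp
  then have 2: "exp (- 5 / 2) \<le> 2 / (7 :: real)" by (simp add: exp_minus field_simps)
  have "sqrt 2 \<ge> (7 / 5 :: real)" by (rule real_le_rsqrt) (simp add: power2_eq_square)
  with 1 2 have "exp (1 / 20) + exp (- 5 / 2) \<le> sqrt (2 :: real)" by simp
  then have "exp 1 * (exp (1 / 20) + exp (- 5 / 2)) \<le> exp 1 * sqrt (2 :: real)"
    by (intro mult_left_mono) auto
  then show ?thesis by (simp add: distrib_left exp_add[symmetric] mult.commute)
qed

text \<open>Take the cube root of \<open>c\<close>; the hypothesis raised to the power
  \<open>2 / 3\<close> is the claim on \<open>b\<^sup>2\<close>. With \<open>c = 3 / k\<close> this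
  is the radius at which the cubic error bound \<open>k / 3 * r ^ 3\<close> reaches one.\<close>

lemma exists_radius:
  fixes a c x :: real
  assumes a: "a \<ge> 0" and x: "x \<ge> 0" and c: "c > 0" and le: "a powr (3 / 2) * x powr (3 / 2) \<le> c"
  obtains b where "b > 0" "b ^ 3 = c" "b\<^sup>2 \<ge> a * x"
proof
  let ?b = "c powr (1 / 3)"
  show b: "?b > 0" using c by simp
  have "?b ^ 3 = ?b powr 3" using b by simp
  then show "?b ^ 3 = c" using c by (simp add: powr_powr)
  have "a * x = ((a * x) powr (3 / 2)) powr (2 / 3)" using a x by (simp add: powr_powr)
  also have "\<dots> \<le> c powr (2 / 3)" using le a x by (intro powr_mono2) (auto simp: powr_mult)
  also have "\<dots> = ?b powr 2" by (simp add: powr_powr)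
  also have "\<dots> = ?b\<^sup>2" using b by simp
  finally show "?b\<^sup>2 \<ge> a * x" .
qed

section \<open>The Laplace approximation\<close>

lemma quad_linear:
  assumes "A \<in> carrier_mat d d" "B \<in> carrier_mat d d"
  shows "quad d (A + c \<cdot>\<^sub>m B) x = quad d A x + c * quad d B x"
  using assms unfolding quad_def by (simp add: sum.distrib sum_distrib_left algebra_simps)

text \<open>Taylor's formula is applied to \<open>\<Phi>\<close> and \<open>R\<close> separately, as
  \<open>K\<close> bounds each of their third derivatives; the two intermediate points may differ.
  The first order terms cancel by minimality, and the third order terms give
  \<open>K + e * K\<close>.\<close>

lemma cubic_remainder_at_minimizer:
  assumes Phi: "C_k_on_eucl d 3 \<Phi>" and R: "C_k_on_eucl d 3 R" and e: "e > 0"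
    and I: "\<And>y. y \<in> eucl d \<Longrightarrow> I y = \<Phi> y + e * R y + c"
    and x0: "x0 \<in> eucl d" and I0: "I x0 = 0" and nonneg: "\<And>y. y \<in> eucl d \<Longrightarrow> I y \<ge> 0"
    and S: "pos_def_mat d S"
    and K: "\<And>y. y \<in> eucl d \<Longrightarrow> max (D3_norm d S \<Phi> y) (D3_norm d S R y) \<le> K"
    and z: "z \<in> eucl d"
  shows "\<bar>I z - quad d (hessian d I x0) (\<lambda>i. z i - x0 i) / 2\<bar>
    \<le> (1 + e) * K / 6 * (mat_norm d S (\<lambda>i. z i - x0 i)) ^ 3"
proof -
  define h where "h = (\<lambda>i. z i - x0 i)"
  have C3: "C_k_on_eucl d (Suc (Suc 1)) \<Phi>" "C_k_on_eucl d (Suc (Suc 1)) R"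
    using Phi R by (simp_all add: numeral_3_eq_3)
  have seg: "segment d x0 h 1 = z"
    using z by (auto simp: segment_def h_def eucl_def PiE_iff extensional_def fun_eq_iff)
  obtain s where s: "\<Phi> z = \<Phi> x0 + (\<Sum>i<d. h i * partial i \<Phi> x0) + quad d (hessian d \<Phi> x0) h / 2
      + D3 d \<Phi> (segment d x0 h s) h h h / 6"
    using taylor_along_segment[OF Phi x0, of h] unfolding seg by blast
  obtain t where t: "R z = R x0 + (\<Sum>i<d. h i * partial i R x0) + quad d (hessian d R x0) h / 2
      + D3 d R (segment d x0 h t) h h h / 6"
    using taylor_along_segment[OF R x0, of h] unfolding seg by blast
  define DP where "DP = D3 d \<Phi> (segment d x0 h s) h h h"
  define DR where "DR = D3 d R (segment d x0 h t) h h h"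
  have "((\<lambda>t. \<Phi> (segment d x0 h t) + e * R (segment d x0 h t) + c) has_real_derivative
      (\<Sum>i<d. h i * partial i \<Phi> (segment d x0 h 0)) + e * (\<Sum>i<d. h i * partial i R (segment d x0 h 0)) + 0) (at 0)"
    by (intro DERIV_add DERIV_cmult DERIV_const has_derivative_along_segment[OF C3(1)]
      has_derivative_along_segment[OF C3(2)])
  then have "((\<lambda>t. I (segment d x0 h t)) has_real_derivative
      (\<Sum>i<d. h i * partial i \<Phi> x0) + e * (\<Sum>i<d. h i * partial i R x0)) (at 0)"
    using segment_0[OF x0] by (simp add: I)
  \<comment> \<open>This is the derivative of \<open>I\<close> in the direction \<open>h\<close>
    only; along the line \<open>I\<close> has a minimum at zero.\<close>
  then have grad: "(\<Sum>i<d. h i * partial i \<Phi> x0) + e * (\<Sum>i<d. h i * partial i R x0) = 0"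
    by (rule DERIV_local_min[of _ _ _ 1]) (auto simp: segment_0[OF x0] I0 nonneg)
  have hess: "quad d (hessian d I x0) h = quad d (hessian d \<Phi> x0) h + e * quad d (hessian d R x0) h"
    using quad_linear[of "hessian d \<Phi> x0" d "hessian d R x0" e h] hessian_linear[OF C3 I x0]
    by (simp add: hessian_def)
  have "I z = I x0 + ((\<Sum>i<d. h i * partial i \<Phi> x0) + e * (\<Sum>i<d. h i * partial i R x0))
      + quad d (hessian d I x0) h / 2 + (DP + e * DR) / 6"
    unfolding I[OF z] I[OF x0] hess s t DP_def DR_def by (simp add: field_simps)
  then have rem: "I z - quad d (hessian d I x0) h / 2 = (DP + e * DR) / 6" using grad I0 by simp
  have "\<bar>DP + e * DR\<bar> \<le> (1 + e) * K * (mat_norm d S h) ^ 3"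
  proof -
    have n: "(mat_norm d S h) ^ 3 \<ge> 0" unfolding mat_norm_def by (intro zero_le_power L2_set_nonneg)
    have "\<bar>DP\<bar> \<le> K * (mat_norm d S h) ^ 3"
      using abs_D3_le_D3_norm[OF S, of \<Phi> _ h] K[OF segment_in_eucl[of d x0 h s]] n unfolding DP_def
      by (meson max.boundedE mult_right_mono order_trans)
    moreover have "\<bar>DR\<bar> \<le> K * (mat_norm d S h) ^ 3"
      using abs_D3_le_D3_norm[OF S, of R _ h] K[OF segment_in_eucl[of d x0 h t]] n unfolding DR_def
      by (meson max.boundedE mult_right_mono order_trans)
    then have "\<bar>e * DR\<bar> \<le> e * (K * (mat_norm d S h) ^ 3)"
      using e by (simp add: abs_mult mult_left_mono)
    ultimately have "\<bar>DP + e * DR\<bar> \<le> K * (mat_norm d S h) ^ 3 + e * (K * (mat_norm d S h) ^ 3)"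
      by linarith
    then show ?thesis by (simp add: algebra_simps)
  qed
  then have "\<bar>I z - quad d (hessian d I x0) h / 2\<bar> \<le> ((1 + e) * K * (mat_norm d S h) ^ 3) / 6"
    unfolding rem by simp
  then show ?thesis unfolding h_def by simp
qed

text \<open>The inverse of \<open>e \<cdot>\<^sub>m inv_mat H\<close> is \<open>H\<close> scaled by
  \<open>1 / e\<close>. The normalising constant is left in the shape of
  \<open>gaussian_has_bochner_integral\<close> at \<open>c = 1 / (2 * e)\<close>.\<close>

lemma gaussian_inv_mat_eq:
  assumes H: "pos_def_mat d H" and e: "e > 0"
  shows "gaussian d m (e \<cdot>\<^sub>m inv_mat H) = density (leb d)
    (\<lambda>x. ennreal (exp (- (1 / (2 * e)) * quad d H (\<lambda>i. x i - m i)) / sqrt ((pi / (1 / (2 * e))) ^ d / det H)))"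
proof -
  note Hc = pos_def_mat_carrier[OF H] and i = pos_def_mat_inv_inverts[OF H]
  have "(e \<cdot>\<^sub>m inv_mat H) * ((1 / e) \<cdot>\<^sub>m H) = (1 / e) \<cdot>\<^sub>m (e \<cdot>\<^sub>m (inv_mat H * H))"
    using Hc i(1) by (simp add: mult_smult_assoc_mat[of _ d d _ d] mult_smult_distrib[of _ d d _ d])
  also have "\<dots> = 1\<^sub>m d" using e i(3) by (auto intro!: eq_matI)
  finally have inv: "inv_mat (e \<cdot>\<^sub>m inv_mat H) = (1 / e) \<cdot>\<^sub>m H"
    using Hc i(1) by (intro inv_mat_eqI) auto
  have "det (inv_mat H) * det H = 1" using det_mult[OF i(1) Hc] i(3) by simp
  then have "det (inv_mat H) = 1 / det H" using pos_def_mat_det_nonzero[OF H] by (simp add: field_simps)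
  then have det: "(2 * pi) ^ d * det (e \<cdot>\<^sub>m inv_mat H) = (pi / (1 / (2 * e))) ^ d / det H"
    using i(1) by (simp add: det_smult power_mult_distrib)
  have "vec d x \<bullet> (((1 / e) \<cdot>\<^sub>m H) *\<^sub>v vec d x) = quad d H x / e" for x
  proof -
    have "vec d x \<bullet> (((1 / e) \<cdot>\<^sub>m H) *\<^sub>v vec d x) = quad d ((1 / e) \<cdot>\<^sub>m H) (vec_index (vec d x))"
      using Hc by (intro scalar_prod_eq_quad) auto
    also have "\<dots> = quad d ((1 / e) \<cdot>\<^sub>m H) x" by (rule quad_cong) simp
    also have "\<dots> = quad d H x / e"
      using Hc unfolding quad_def by (simp add: sum_divide_distrib)
    finally show ?thesis .
  qed
  then show ?thesis unfolding gaussian_def inv det Let_def by (simp add: field_simps)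
qed

text \<open>The estimate in a single fixed dimension. The threshold 100 is the one in
  \<open>gaussian_bulk_le\<close> and \<open>gaussian_tail_le\<close>.\<close>

lemma laplace_approximation_tv_dist_le:
  assumes d: "d \<ge> 100" and e: "0 < e" "e \<le> 1" and K0: "K > 0"
    and Phi: "C_k_on_eucl d 3 \<Phi>" and R: "C_k_on_eucl d 3 R"
    and I: "\<And>y. I y = \<Phi> y + e * R y + c"
    and x0: "x0 \<in> eucl d" and I0: "I x0 = 0"
    and H: "pos_def_mat d (hessian d I x0)" and S: "S = inv_mat (hessian d I x0)"
    and K: "\<And>y. y \<in> eucl d \<Longrightarrow> max (D3_norm d S \<Phi> y) (D3_norm d S R y) \<le> K"
    and \<delta>: "0 < \<delta>" "\<delta> \<le> exp (- 1 / 2)"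
    and lower: "\<And>y. y \<in> eucl d \<Longrightarrow> I y \<ge> \<delta> / 2 * (mat_norm d S (\<lambda>i. y i - x0 i))\<^sup>2"
    and large: "3 / (sqrt e * K) \<ge> (8 / \<delta> * ln (1 / \<delta>)) powr (3 / 2) * real d powr (3 / 2)"
  shows "tv_dist d (posterior d e I) (gaussian d x0 (e \<cdot>\<^sub>m S))
    \<le> 2 * sqrt 2 * exp 1 / 3 * (sqrt e * K * real d powr (3 / 2))"
proof -
  define A where "A = hessian d I x0"
  define k where "k = sqrt e * K"
  define q where "q x = quad d A (\<lambda>i. x i - x0 i)" for x
  \<comment> \<open>The length of the rescaled coordinate \<open>u\<close>; the Gaussian integrals
    and the pointwise bounds involve \<open>u\<close> through this length only.\<close>
  define r where "r x = mat_norm d S (\<lambda>i. x i - x0 i) / sqrt e" for x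
  have A: "pos_def_mat d A" unfolding A_def by (rule H)
  have pdS: "pos_def_mat d S" unfolding S by (rule pos_def_mat_inv_mat[OF H])
  have k: "k > 0" using e K0 by (simp add: k_def)
  have r0: "r x \<ge> 0" for x unfolding r_def mat_norm_def using e by (simp add: L2_set_nonneg)
  have mn: "(mat_norm d S (\<lambda>i. x i - x0 i))\<^sup>2 = q x" for x
    using mat_norm_power2[OF pdS] inv_mat_inv_mat[OF H] by (simp add: q_def S A_def)
  have r2: "(r x)\<^sup>2 = q x / e" for x
    using e by (simp add: r_def power_divide mn)
  have "exp (- 1 / 2) \<le> (1 :: real)" by (subst exp_le_one_iff) simp
  then have \<delta>1: "\<delta> \<le> 1" using \<delta>(2) by (rule order_trans[rotated])
  then have "ln (1 / \<delta>) \<ge> 0" using \<delta> by (simp add: ln_div)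
  then obtain b where b: "b > 0" "b ^ 3 = 3 / k" "b\<^sup>2 \<ge> 8 / \<delta> * ln (1 / \<delta>) * real d"
    using exists_radius[of "8 / \<delta> * ln (1 / \<delta>)" "real d" "3 / k"] large \<delta> k unfolding k_def by auto
  have kb: "k = 3 / b ^ 3" using b k by simp
  have nonneg: "I y \<ge> 0" if "y \<in> eucl d" for y
    using lower[OF that] \<delta> by (smt (verit) divide_nonneg_nonneg mult_nonneg_nonneg zero_le_power2)

  \<comment> \<open>The unnormalised densities and their masses\<close>
  define f where "f x = exp (- (1 / e) * I x)" for x
  define g where "g x = exp (- (1 / (2 * e)) * q x)" for x
  define N where "N = sqrt ((pi / (1 / (2 * e))) ^ d / det A)"
  have detA: "det A > 0" by (rule pos_def_mat_det_pos[OF A])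
  have N: "N > 0" using e detA by (simp add: N_def)
  \<comment> \<open>All Gaussian masses relative to \<open>N\<close>: \<open>t = 1\<close> for
    \<open>g\<close>, \<open>t = \<delta>\<close> for a function dominating \<open>f\<close>,
    \<open>t = 1 - 3 / real d\<close> for the bound in the ball, and \<open>t = \<delta> / 2\<close>
    for the bound outside it.\<close>
  have gauss: "has_bochner_integral (leb d) (\<lambda>x. exp (- (t / 2) * (r x)\<^sup>2)) (N * sqrt ((1 / t) ^ d))"
    if t: "t > 0" for t
  proof -
    have "N * sqrt ((1 / t) ^ d) = sqrt ((pi / (t / (2 * e))) ^ d / det A)"
      using t e unfolding N_def real_sqrt_mult[symmetric] times_divide_eq_left power_mult_distrib[symmetric]
      by (simp add: field_simps)
    then show ?thesis
      using gaussian_has_bochner_integral[of "t / (2 * e)" d A x0] A t e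
      unfolding r2 q_def by (simp add: field_simps)
  qed
  have g_eq: "g x = exp (- (r x)\<^sup>2 / 2)" for x using e by (simp add: g_def r2)
  have g_int: "has_bochner_integral (leb d) g N" using gauss[of 1] by (simp add: g_eq[abs_def])
  then have gi: "integrable (leb d) g" and Ng: "(\<integral>x. g x \<partial>leb d) = N"
    by (auto simp: has_bochner_integral_iff)
  have space: "space (leb d) = eucl d" by (simp add: leb_def eucl_def space_PiM)
  have "I = (\<lambda>y. \<Phi> y + e * R y + c)" using I by auto
  then have Im: "I \<in> borel_measurable (leb d)"
    using borel_measurable_leb_continuous[OF C_k_on_eucl_continuous[OF Phi]]
      borel_measurable_leb_continuous[OF C_k_on_eucl_continuous[OF R]] by simp
  have V_lower: "1 / e * I x \<ge> \<delta> / 2 * (r x)\<^sup>2" if "x \<in> eucl d" for x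
    using lower[OF that] e unfolding mn r2 by (simp add: field_simps)
  have near: "\<bar>1 / e * I x - (r x)\<^sup>2 / 2\<bar> \<le> k / 3 * r x ^ 3" if "x \<in> eucl d" for x
  proof -
    let ?m = "mat_norm d S (\<lambda>i. x i - x0 i)"
    have m: "?m ^ 3 \<ge> 0" unfolding mat_norm_def by (intro zero_le_power L2_set_nonneg)
    have "\<bar>I x - q x / 2\<bar> \<le> (1 + e) * K / 6 * ?m ^ 3"
      using cubic_remainder_at_minimizer[OF Phi R e(1) I x0 I0 nonneg pdS K that]
      unfolding q_def A_def .
    \<comment> \<open>Here \<open>e \<le> 1\<close> gives \<open>(1 + e) / 6 \<le> 1 / 3\<close>.
      Division by \<open>e\<close> then turns \<open>K * ?m ^ 3\<close> into
      \<open>k * r x ^ 3\<close>, since \<open>sqrt e ^ 3 = sqrt e * e\<close>.\<close>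
    also have "\<dots> \<le> K / 3 * ?m ^ 3"
      using e K0 m by (intro mult_right_mono) (auto simp: field_simps)
    finally have "1 / e * \<bar>I x - q x / 2\<bar> \<le> 1 / e * (K / 3 * ?m ^ 3)"
      using e by (intro mult_left_mono) auto
    also have "1 / e * \<bar>I x - q x / 2\<bar> = \<bar>1 / e * (I x - q x / 2)\<bar>"
      using e by (simp add: abs_mult)
    also have "1 / e * (I x - q x / 2) = 1 / e * I x - (r x)\<^sup>2 / 2"
      using e by (simp add: r2 field_simps)
    also have "1 / e * (K / 3 * ?m ^ 3) = k / 3 * r x ^ 3"
    proof -
      have "sqrt e ^ 3 = sqrt e * e" using e by (simp add: power3_eq_cube)
      then show ?thesis using e by (simp add: r_def k_def power_divide)
    qed
    finally show ?thesis .
  qed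
  have fi: "integrable (leb d) f"
  proof (rule Bochner_Integration.integrable_bound)
    show "integrable (leb d) (\<lambda>x. exp (- (\<delta> / 2) * (r x)\<^sup>2))"
      using gauss[OF \<delta>(1)] by (auto simp: has_bochner_integral_iff)
    show "f \<in> borel_measurable (leb d)" unfolding f_def using Im by measurable
    show "AE x in leb d. norm (f x) \<le> norm (exp (- (\<delta> / 2) * (r x)\<^sup>2))"
      using V_lower space by (intro AE_I2) (auto simp: f_def)
  qed
  \<comment> \<open>As \<open>f\<close> vanishes nowhere, a zero integral would make
    \<open>leb d\<close> a null measure, contrary to the positive mass \<open>N\<close> of
    \<open>g\<close>.\<close>
  have "(\<integral>x. f x \<partial>leb d) \<noteq> 0"
  proof
    assume "(\<integral>x. f x \<partial>leb d) = 0"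
    then have "AE x in leb d. f x = 0"
      using fi by (subst (asm) integral_nonneg_eq_0_iff_AE) (auto simp: f_def)
    then have "AE x in leb d. g x = 0" by eventually_elim (simp add: f_def)
    then have "(\<integral>x. g x \<partial>leb d) = 0" by (rule integral_eq_zero_AE)
    then show False using Ng N by simp
  qed
  moreover have "(\<integral>x. f x \<partial>leb d) \<ge> 0" by (intro integral_nonneg_AE) (auto simp: f_def)
  ultimately have Zpos: "(\<integral>x. f x \<partial>leb d) > 0" by simp

  \<comment> \<open>The \<open>L\<^sup>1\<close> distance of the unnormalised densities\<close>
  define P where "P = k / 3 * exp (- 1 / 2) * real d powr (3 / 2)"
  define T where "T = exp (- \<delta> * b\<^sup>2 / 4)"
  \<comment> \<open>The coefficient \<open>\<delta> / 2 / 2\<close> is the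
    \<open>\<delta> / 4\<close> of the pointwise bound, written so that \<open>gauss\<close> applies
    with \<open>t = \<delta> / 2\<close>.\<close>
  define u where "u x = P * exp (- ((1 - 3 / real d) / 2) * (r x)\<^sup>2) + T * exp (- (\<delta> / 2 / 2) * (r x)\<^sup>2)" for x
  have u: "has_bochner_integral (leb d) u
      (P * (N * sqrt ((1 / (1 - 3 / real d)) ^ d)) + T * (N * sqrt ((1 / (\<delta> / 2)) ^ d)))"
    unfolding u_def using d \<delta>
    by (intro has_bochner_integral_add has_bochner_integral_mult_right gauss) auto
  have "(\<integral>x. \<bar>f x - g x\<bar> \<partial>leb d) \<le> (\<integral>x. u x \<partial>leb d)"
  proof (rule integral_mono)
    show "integrable (leb d) (\<lambda>x. \<bar>f x - g x\<bar>)" using fi gi by auto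
    show "integrable (leb d) u" using u by (simp add: has_bochner_integral_iff)
    fix x assume "x \<in> space (leb d)"
    then have x: "x \<in> eucl d" using space by simp
    show "\<bar>f x - g x\<bar> \<le> u x"
      using abs_exp_minus_gaussian_le[OF r0 b(1) kb \<delta>(1) \<delta>1 _ V_lower[OF x] near[OF x], of "real d"] d
      unfolding f_def g_eq u_def P_def T_def by simp
  qed
  also have "\<dots> = N * (P * sqrt ((1 / (1 - 3 / real d)) ^ d) + T * sqrt ((2 / \<delta>) ^ d))"
    using u by (simp add: has_bochner_integral_iff algebra_simps)
  also have "\<dots> \<le> N * (k / 3 * real d powr (3 / 2) * (exp (21 / 20) + exp (- 3 / 2)))"
  proof (rule mult_left_mono)
    have "P * sqrt ((1 / (1 - 3 / real d)) ^ d) \<le> P * exp (31 / 20)"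
      using gaussian_bulk_le[OF d] k by (intro mult_left_mono) (auto simp: P_def)
    also have "\<dots> = k / 3 * real d powr (3 / 2) * exp (- 1 / 2 + 31 / 20)"
      unfolding exp_add P_def by simp
    finally have "P * sqrt ((1 / (1 - 3 / real d)) ^ d) \<le> k / 3 * real d powr (3 / 2) * exp (21 / 20)"
      by simp
    \<comment> \<open>The tail estimate is in terms of \<open>1 / b ^ 3\<close>, which is
      \<open>k / 3\<close>.\<close>
    moreover have "T * sqrt ((2 / \<delta>) ^ d) \<le> k / 3 * real d powr (3 / 2) * exp (- 3 / 2)"
      using gaussian_tail_le[OF d b(1) \<delta> b(3)] b(1) unfolding T_def kb by (simp add: field_simps)
    ultimately show "P * sqrt ((1 / (1 - 3 / real d)) ^ d) + T * sqrt ((2 / \<delta>) ^ d)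
        \<le> k / 3 * real d powr (3 / 2) * (exp (21 / 20) + exp (- 3 / 2))"
      unfolding distrib_left by (rule add_mono)
  qed (use N in simp)
  also have "\<dots> \<le> N * (k / 3 * real d powr (3 / 2) * (sqrt 2 * exp 1))"
    using exp_constants_le N k by (intro mult_left_mono) auto
  finally have D: "2 * (\<integral>x. \<bar>f x - g x\<bar> \<partial>leb d) / N \<le> 2 * sqrt 2 * exp 1 / 3 * (k * real d powr (3 / 2))"
    using N by (simp add: field_simps)

  \<comment> \<open>Passage to total variation\<close>
  have post: "posterior d e I = density (leb d) (\<lambda>x. ennreal (f x / (\<integral>x. f x \<partial>leb d)))"
    unfolding posterior_def f_def ..
  have gau: "gaussian d x0 (e \<cdot>\<^sub>m S) = density (leb d) (\<lambda>x. ennreal (g x / (\<integral>x. g x \<partial>leb d)))"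
    unfolding S A_def[symmetric] gaussian_inv_mat_eq[OF A e(1)] Ng
    unfolding g_def q_def N_def ..
  show ?thesis
    unfolding tv_dist_def
  proof (rule cSUP_least)
    fix B assume "B \<in> sets (leb d)"
    moreover have "f x \<ge> 0" "g x \<ge> 0" for x by (simp_all add: f_def g_def)
    moreover have "(\<integral>x. g x \<partial>leb d) > 0" using Ng N by simp
    ultimately have "\<bar>measure (posterior d e I) B - measure (gaussian d x0 (e \<cdot>\<^sub>m S)) B\<bar>
        \<le> 2 * (\<integral>x. \<bar>f x - g x\<bar> \<partial>leb d) / N"
      using measure_normalized_density_diff_le[OF fi _ gi _ Zpos, of B] unfolding post gau Ng by blast
    then show "\<bar>measure (posterior d e I) B - measure (gaussian d x0 (e \<cdot>\<^sub>m S)) B\<bar>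
        \<le> 2 * sqrt 2 * exp 1 / 3 * (sqrt e * K * real d powr (3 / 2))"
      using D unfolding k_def by linarith
  qed (use sets.top in blast)
qed

theorem corollary4p6:
  fixes G :: "nat \<Rightarrow> (nat \<Rightarrow> real) \<Rightarrow> (nat \<Rightarrow> real)"
    and y xhat :: "nat \<Rightarrow> (nat \<Rightarrow> real)"
    and \<Phi> R I :: "nat \<Rightarrow> (nat \<Rightarrow> real) \<Rightarrow> real"
    and \<Sigma> :: "nat \<Rightarrow> real mat"
    and \<epsilon> K \<delta> :: "nat \<Rightarrow> real"
    and N0 :: nat and C :: real
  assumes eps_pos: "\<And>d. d \<ge> 1 \<Longrightarrow> \<epsilon> d > 0"
    and y_mem: "\<And>d. d \<ge> 1 \<Longrightarrow> y d \<in> eucl d"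
    and G_mem: "\<And>d. d \<ge> 1 \<Longrightarrow> G d \<in> eucl d \<rightarrow> eucl d"
    and prior: "\<And>d. d \<ge> 1 \<Longrightarrow> prob_space (density (leb d) (\<lambda>x. ennreal (exp (- R d x))))"
    and Phi_eq: "\<And>d x. \<Phi> d x = 1 / 2 * (L2_set (\<lambda>i. y d i - G d x i) {..<d})\<^sup>2"
    and xhat: "\<And>d. d \<ge> 1 \<Longrightarrow> unique_minimizer d (\<lambda>x. \<Phi> d x + \<epsilon> d * R d x) (xhat d)"
    and I_eq: "\<And>d x. I d x = \<Phi> d x + \<epsilon> d * R d x - \<Phi> d (xhat d) - \<epsilon> d * R d (xhat d)"
    and Sigma_eq: "\<And>d. \<Sigma> d = inv_mat (hessian d (I d) (xhat d))"
    and Phi_C3: "\<And>d. d \<ge> 1 \<Longrightarrow> C_k_on_eucl d 3 (\<Phi> d)"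
    and R_C3: "\<And>d. d \<ge> 1 \<Longrightarrow> C_k_on_eucl d 3 (R d)"
    and I_min: "\<And>d. d \<ge> 1 \<Longrightarrow> unique_minimizer d (I d) (xhat d)"
    and hessian_pos_def: "\<And>d. d \<ge> 1 \<Longrightarrow> pos_def_mat d (hessian d (I d) (xhat d))"
    and K_pos: "\<And>d. d \<ge> 1 \<Longrightarrow> K d > 0"
    and K_bound: "\<And>d x. d \<ge> 1 \<Longrightarrow> x \<in> eucl d \<Longrightarrow>
           max (D3_norm d (\<Sigma> d) (\<Phi> d) x) (D3_norm d (\<Sigma> d) (R d) x) \<le> K d"
    and delta: "\<And>d. d \<ge> 1 \<Longrightarrow> 0 < \<delta> d \<and> \<delta> d \<le> 1"
    and I_lower: "\<And>d x. d \<ge> 1 \<Longrightarrow> x \<in> eucl d \<Longrightarrow>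
           I d x \<ge> \<delta> d / 2 * (mat_norm d (\<Sigma> d) (\<lambda>i. x i - xhat d i))\<^sup>2"
    and limit: "(\<lambda>d. sqrt (\<epsilon> d) * K d) \<longlonglongrightarrow> 0"
    and N0: "N0 \<ge> 1"
    and large_d: "\<And>d. d \<ge> N0 \<Longrightarrow> \<delta> d \<le> exp (- 1 / 2) \<and> \<epsilon> d \<le> 1 \<and>
           3 / (sqrt (\<epsilon> d) * K d)
             \<ge> (8 / \<delta> d * ln (1 / \<delta> d)) powr (3 / 2) * real d powr (3 / 2)"
    and C: "C > 2 * sqrt 2 * exp 1 / 3"
  shows "\<exists>N1\<ge>N0. \<forall>d\<ge>N1.
           tv_dist d (posterior d (\<epsilon> d) (I d)) (gaussian d (xhat d) (\<epsilon> d \<cdot>\<^sub>m \<Sigma> d))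
             \<le> C * sqrt (\<epsilon> d) * K d * real d powr (3 / 2)"
\<comment> \<open>From 100 on the estimate in a single dimension applies with the constant
  \<open>2 * sqrt 2 * exp 1 / 3\<close>, which \<open>C\<close> exceeds.\<close>
proof (intro exI[of _ "max N0 100"] conjI allI impI)
  fix d assume "max N0 100 \<le> d"
  then have d: "d \<ge> N0" "d \<ge> 100" "d \<ge> 1" by auto
  have x0: "xhat d \<in> eucl d"
    using I_min[OF d(3)] unfolding unique_minimizer_def is_arg_min_def by blast
  have "tv_dist d (posterior d (\<epsilon> d) (I d)) (gaussian d (xhat d) (\<epsilon> d \<cdot>\<^sub>m \<Sigma> d))
      \<le> 2 * sqrt 2 * exp 1 / 3 * (sqrt (\<epsilon> d) * K d * real d powr (3 / 2))"
  proof (rule laplace_approximation_tv_dist_le[OF d(2) eps_pos[OF d(3)] _ K_pos[OF d(3)]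
      Phi_C3[OF d(3)] R_C3[OF d(3)] _ x0 _ hessian_pos_def[OF d(3)] Sigma_eq K_bound[OF d(3)] _ _ I_lower[OF d(3)]])
    show "I d x = \<Phi> d x + \<epsilon> d * R d x + (- \<Phi> d (xhat d) - \<epsilon> d * R d (xhat d))" for x
      unfolding I_eq by simp
    show "I d (xhat d) = 0" unfolding I_eq by simp
  qed (use large_d[OF d(1)] delta[OF d(3)] in auto)
  also have "\<dots> \<le> C * (sqrt (\<epsilon> d) * K d * real d powr (3 / 2))"
    using C eps_pos[OF d(3)] K_pos[OF d(3)] by (intro mult_right_mono) auto
  finally show "tv_dist d (posterior d (\<epsilon> d) (I d)) (gaussian d (xhat d) (\<epsilon> d \<cdot>\<^sub>m \<Sigma> d))
      \<le> C * sqrt (\<epsilon> d) * K d * real d powr (3 / 2)" by (simp add: mult_ac)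
qed simp

end
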